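(* Let $(\mathcal{C},\mathcal{M})$ be an AECat with the amalgamation property and let $\mathop{\perp\!\!\!\perp}$ be a basic independence relation that also satisfies Club Local Character. Then for every model $M$ and subobjects $A,B,C\le M$ with $C\in\mathrm{base}(\mathop{\perp\!\!\!\perp})$, $A\mathop{\perp\!\!\!\perp}^{\mathrm{isi\text{-}d},M}_CB$ implies $A\mathop{\perp\!\!\!\perp}_C^MB$. Moreover, if $\mathop{\perp\!\!\!\perp}$ satisfies all these assumptions except possibly Union, then for all such $A,B,C$, $A\mathop{\perp\!\!\!\perp}^{\mathrm{ld},M}_CB$ implies $A\mathop{\perp\!\!\!\perp}_C^MB$.
   Context: All cardinals are regular. An AECat is a pair $(\mathcal{C},\mathcal{M})$ of accessible categories with $\mathcal{M}$ a full subcategory of $\mathcal{C}$, $\mathcal{M}$ having directed colimits preserved by the inclusion, and every arrow of $\mathcal{C}$ a monomorphism; objects of $\mathcal{M}$ are models. AP: every span of models completes to a commutative square into a model. An extension of a model $M$ is an arrow $M\to N$ with $N$ a model; given it and $a:A\to M$ we also write $a$ for $A\to M\to N$, and subobjects of $M$ are regarded as subobjects of $N$. $(a,b,\dots;M)$ means $M$ is a model and $a,b,\dots$ arrows into $M$. $\mathrm{gtp}((a_i)_i;M)=\mathrm{gtp}((a_i')_i;M')$ means $\mathrm{dom}(a_i)=\mathrm{dom}(a_i')$ and there are extensions $f:M\to N$, $f':M'\to N$ with $fa_i=f'a_i'$ for all $i$. A base class is a collection of objects of $\mathcal{C}$ containing all models; $C\in\mathcal{B}$ for a subobject means its domain is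 in $\mathcal{B}$. An independence relation is a relation on triples of subobjects of a model $M$, written $A\mathop{\perp\!\!\!\perp}_C^MB$ (arrows may replace the subobjects they represent; $M\le M$), with $\mathrm{base}(\mathop{\perp\!\!\!\perp})$ a base class such that $A\mathop{\perp\!\!\!\perp}_C^MB$ implies $C\in\mathrm{base}(\mathop{\perp\!\!\!\perp})$. Basic means it satisfies: Invariance ($a\mathop{\perp\!\!\!\perp}_c^Mb$, $\mathrm{gtp}(a,b,c;M)=\mathrm{gtp}(a',b',c';M')$ imply $a'\mathop{\perp\!\!\!\perp}_{c'}^{M'}b'$); Monotonicity ($A\mathop{\perp\!\!\!\perp}_C^MB$, $A'\le A$ imply $A'\mathop{\perp\!\!\!\perp}_C^MB$); Transitivity ($A\mathop{\perp\!\!\!\perp}_B^MC$, $A\mathop{\perp\!\!\!\perp}_C^MD$, $B\le C$ imply $A\mathop{\perp\!\!\!\perp}_B^MD$); Symmetry; Existence ($A\mathop{\perp\!\!\!\perp}_C^MC$ for $C\in\mathrm{base}(\mathop{\perp\!\!\!\perp})$); Extension (if $a\mathop{\perp\!\!\!\perp}_c^Mb$ and $b$ factors through $(b';M)$, there are an extension $M\to N$ and $(a';N)$ with $\mathrm{gtp}(a',b,c;N)=\mathrm{gtp}(a,b,c;M)$, $a'\mathop{\perp\!\!\!\perp}_c^Nb'$); Union (if $(B_i)_{i\in I}$ is directed with a cocone into a model $M$ and $B=\mathrm{colim}_iB_i$ exists, $A\mathop{\perp\!\!\!\perp}_C^MB_i$ for all $i$ implies $A\mathop{\perp\!\!\!\perp}_C^MB$).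 Club Local Character: with $\mathrm{Sub}^\kappa_{\mathcal{M}}(M)$ the poset of subobjects of $M$ in $\mathcal{M}$ with $\kappa$-presentable domain, and a nonempty $\mathcal{F}$ in it called club if every element is below some element of $\mathcal{F}$ and joins $\mathrm{colim}_{i<\theta}M_i$ of chains in $\mathcal{F}$ with $\theta<\kappa$ lie in $\mathcal{F}$: for every $\lambda$ there is $\Upsilon(\lambda)$ such that for all $\kappa\ge\Upsilon(\lambda)$, whenever $A,M\le N$ with $A$ $\lambda$-presentable and $M$ a model, there is a club $\mathcal{F}\subseteq\mathrm{Sub}^\kappa_{\mathcal{M}}(M)$ with $A\mathop{\perp\!\!\!\perp}_{M_0}^NM$ for all $M_0\in\mathcal{F}$. A chain of initial segments for $((b_i)_{i<\lambda};N)$ (same domains) is a continuous chain of models $(M_i)_{i<\lambda}$ with a cocone $m_i:M_i\to N$ such that $b_i$ factors through $m_{i+1}$; $c$ embeds in it if $c$ factors through $m_0$; it is an isi-sequence over $c$ if $c$ embeds and $\mathrm{gtp}(b_i,m_i;N)=\mathrm{gtp}(b_j,m_i;N)$ for $i\le j$. For a sequence $(b_i)_{i\in I}$ in an extension $N$ of $M$ with $\mathrm{gtp}(b_i,c;N)=\mathrm{gtp}(b,c;M)$, $\mathrm{gtp}(a,b,c;M)$ is consistent for it if there are an extension $N\to N'$ and $(a';N')$ with $\mathrm{gtp}(a',b_i,c;N')=\mathrm{gtp}(a,b,c;M)$ for all $i\in I$. $\mathrm{gtp}(a,b,c;M)$ long divides over $c$ if there is $\mu$ such that for every $\lambda\ge\mu$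 there are a sequence $(b_i)_{i<\lambda}$ in an extension $N$ of $M$ with $\mathrm{gtp}(b_i,c;N)=\mathrm{gtp}(b,c;M)$ and $\kappa<\lambda$ such that for every $I\subseteq\lambda$ with $|I|=\kappa$ it is not consistent for $(b_i)_{i\in I}$; it isi-divides over $c$ if this holds with the sequences required to be isi-sequences over $c$. $A\mathop{\perp\!\!\!\perp}^{\mathrm{ld},M}_CB$ (resp. $\mathop{\perp\!\!\!\perp}^{\mathrm{isi\text{-}d}}$) means $\mathrm{gtp}(a,b,c;M)$ does not long divide (resp. isi-divide) over $c$ for representatives $a,b,c$ of $A,B,C$ (independent of the choice). *)

theory Defs
  imports Main
begin

unbundle cardinal_syntax

section \<open>Smallness and cardinals\<close>

text \<open>
  The set/class distinction is rendered by a Grothendieck universe: a type \<open>'u\<close> whose cardinality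
  is (uncountable and) strongly inaccessible. "Small" means of cardinality less than that of \<open>'u\<close>.
  Cardinals, like all small index sets, are realised on subsets of \<open>'u\<close>. A parameter
  \<open>U :: 'u itself\<close> only serves to name the universe.
\<close>

definition small :: "'u itself \<Rightarrow> 'b set \<Rightarrow> bool" where
  "small U A \<longleftrightarrow> |A| <o |UNIV :: 'u set|"

definition universe :: "'u itself \<Rightarrow> bool" where
  "universe U \<longleftrightarrow>
     natLeq <o |UNIV :: 'u set| \<and>
     regularCard |UNIV :: 'u set| \<and>
     (\<forall>A :: 'u set. small U A \<longrightarrow> small U (Pow A))"

text \<open>Small infinite regular cardinals; the elements of the cardinal are those of its field.\<close>

definition reg_card :: "'u rel \<Rightarrow> bool" where
  "reg_card \<kappa> \<longleftrightarrow> Card_order \<kappa> \<and> cinfinite \<kappa> \<and> regularCard \<kappa> \<and> \<kappa> <o |UNIV :: 'u set|"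

section \<open>Categories, directed colimits, accessibility\<close>

record ('o, 'a) category =
  Obj :: "'o set"
  Arr :: "'a set"
  Dom :: "'a \<Rightarrow> 'o"
  Cod :: "'a \<Rightarrow> 'o"
  Id :: "'o \<Rightarrow> 'a"
  Comp :: "'a \<Rightarrow> 'a \<Rightarrow> 'a" (infixr "\<cdot>\<index>" 70)

definition hom :: "('o, 'a) category \<Rightarrow> 'o \<Rightarrow> 'o \<Rightarrow> 'a set" where
  "hom C X Y = {f \<in> Arr C. Dom C f = X \<and> Cod C f = Y}"

definition is_category :: "('o, 'a) category \<Rightarrow> bool" where
  "is_category C \<longleftrightarrow>
     (\<forall>f \<in> Arr C. Dom C f \<in> Obj C \<and> Cod C f \<in> Obj C) \<and>
     (\<forall>X \<in> Obj C. Id C X \<in> hom C X X) \<and>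
     (\<forall>X Y Z f g. f \<in> hom C X Y \<and> g \<in> hom C Y Z \<longrightarrow> g \<cdot>\<^bsub>C\<^esub> f \<in> hom C X Z) \<and>
     (\<forall>X Y f. f \<in> hom C X Y \<longrightarrow> f \<cdot>\<^bsub>C\<^esub> Id C X = f \<and> Id C Y \<cdot>\<^bsub>C\<^esub> f = f) \<and>
     (\<forall>W X Y Z f g h. f \<in> hom C W X \<and> g \<in> hom C X Y \<and> h \<in> hom C Y Z \<longrightarrow>
        h \<cdot>\<^bsub>C\<^esub> (g \<cdot>\<^bsub>C\<^esub> f) = (h \<cdot>\<^bsub>C\<^esub> g) \<cdot>\<^bsub>C\<^esub> f)"

definition locally_small :: "'u itself \<Rightarrow> ('o, 'a) category \<Rightarrow> bool" where
  "locally_small U C \<longleftrightarrow> (\<forall>X \<in> Obj C. \<forall>Y \<in> Obj C. small U (hom C X Y))"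

definition mono_arr :: "('o, 'a) category \<Rightarrow> 'a \<Rightarrow> bool" where
  "mono_arr C f \<longleftrightarrow> f \<in> Arr C \<and>
     (\<forall>X g h. g \<in> hom C X (Dom C f) \<and> h \<in> hom C X (Dom C f) \<and> f \<cdot>\<^bsub>C\<^esub> g = f \<cdot>\<^bsub>C\<^esub> h \<longrightarrow> g = h)"

definition full_sub :: "('o, 'a) category \<Rightarrow> 'o set \<Rightarrow> ('o, 'a) category" where
  "full_sub C S = C\<lparr>Obj := S, Arr := {f \<in> Arr C. Dom C f \<in> S \<and> Cod C f \<in> S}\<rparr>"

text \<open>Directed posets are small and, in both variants, nonempty.\<close>

definition directed_poset :: "'u set \<Rightarrow> 'u rel \<Rightarrow> bool" where
  "directed_poset I r \<longleftrightarrow> small TYPE('u) I \<and> partial_order_on I r \<and> I \<noteq> {} \<and>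
     (\<forall>i \<in> I. \<forall>j \<in> I. \<exists>k \<in> I. (i, k) \<in> r \<and> (j, k) \<in> r)"

definition card_directed_poset :: "'u rel \<Rightarrow> 'u set \<Rightarrow> 'u rel \<Rightarrow> bool" where
  "card_directed_poset \<kappa> I r \<longleftrightarrow> small TYPE('u) I \<and> partial_order_on I r \<and>
     (\<forall>K. K \<subseteq> I \<and> |K| <o \<kappa> \<longrightarrow> (\<exists>k \<in> I. \<forall>i \<in> K. (i, k) \<in> r))"

text \<open>
  Diagrams \<open>(D, \<delta>)\<close> over a poset: \<open>D i\<close> are the objects and \<open>\<delta> i j : D i \<rightarrow> D j\<close>, for \<open>(i, j) \<in> r\<close>,
  the connecting arrows. Only the restriction of \<open>r\<close> to \<open>I\<close> matters.
\<close>

definition diagram ::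
  "('o, 'a) category \<Rightarrow> 'i set \<Rightarrow> 'i rel \<Rightarrow> ('i \<Rightarrow> 'o) \<Rightarrow> ('i \<Rightarrow> 'i \<Rightarrow> 'a) \<Rightarrow> bool" where
  "diagram C I r D \<delta> \<longleftrightarrow>
     (\<forall>i \<in> I. D i \<in> Obj C \<and> \<delta> i i = Id C (D i)) \<and>
     (\<forall>i \<in> I. \<forall>j \<in> I. (i, j) \<in> r \<longrightarrow> \<delta> i j \<in> hom C (D i) (D j)) \<and>
     (\<forall>i \<in> I. \<forall>j \<in> I. \<forall>k \<in> I. (i, j) \<in> r \<and> (j, k) \<in> r \<longrightarrow> \<delta> j k \<cdot>\<^bsub>C\<^esub> \<delta> i j = \<delta> i k)"

definition cocone ::
  "('o, 'a) category \<Rightarrow> 'i set \<Rightarrow> 'i rel \<Rightarrow> ('i \<Rightarrow> 'o) \<Rightarrow> ('i \<Rightarrow> 'i \<Rightarrow> 'a) \<Rightarrow> 'o \<Rightarrow> ('i \<Rightarrow> 'a) \<Rightarrow> bool"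
where
  "cocone C I r D \<delta> L l \<longleftrightarrow> L \<in> Obj C \<and>
     (\<forall>i \<in> I. l i \<in> hom C (D i) L) \<and>
     (\<forall>i \<in> I. \<forall>j \<in> I. (i, j) \<in> r \<longrightarrow> l j \<cdot>\<^bsub>C\<^esub> \<delta> i j = l i)"

definition colimit ::
  "('o, 'a) category \<Rightarrow> 'i set \<Rightarrow> 'i rel \<Rightarrow> ('i \<Rightarrow> 'o) \<Rightarrow> ('i \<Rightarrow> 'i \<Rightarrow> 'a) \<Rightarrow> 'o \<Rightarrow> ('i \<Rightarrow> 'a) \<Rightarrow> bool"
where
  "colimit C I r D \<delta> L l \<longleftrightarrow> cocone C I r D \<delta> L l \<and>
     (\<forall>X x. cocone C I r D \<delta> X x \<longrightarrow>
        (\<exists>!u. u \<in> hom C L X \<and> (\<forall>i \<in> I. u \<cdot>\<^bsub>C\<^esub> l i = x i)))"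

text \<open>
  \<open>hom(X, -)\<close> preserves \<open>\<kappa>\<close>-directed colimits: the two clauses say that the comparison map
  from the directed colimit of the sets \<open>hom(X, D i)\<close> to \<open>hom(X, L)\<close> is onto and one-to-one.
\<close>

definition presentable :: "'u rel \<Rightarrow> ('o, 'a) category \<Rightarrow> 'o \<Rightarrow> bool" where
  "presentable \<kappa> C X \<longleftrightarrow> X \<in> Obj C \<and>
     (\<forall>I r D \<delta> L l. card_directed_poset \<kappa> I r \<and> diagram C I r D \<delta> \<and> colimit C I r D \<delta> L l \<longrightarrow>
        (\<forall>f \<in> hom C X L. \<exists>i \<in> I. \<exists>g \<in> hom C X (D i). l i \<cdot>\<^bsub>C\<^esub> g = f) \<and>
        (\<forall>i \<in> I. \<forall>j \<in> I. \<forall>g \<in> hom C X (D i). \<forall>h \<in> hom C X (D j).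
           l i \<cdot>\<^bsub>C\<^esub> g = l j \<cdot>\<^bsub>C\<^esub> h \<longrightarrow>
           (\<exists>k \<in> I. (i, k) \<in> r \<and> (j, k) \<in> r \<and> \<delta> i k \<cdot>\<^bsub>C\<^esub> g = \<delta> j k \<cdot>\<^bsub>C\<^esub> h)))"

definition accessible :: "'u itself \<Rightarrow> ('o, 'a) category \<Rightarrow> bool" where
  "accessible U C \<longleftrightarrow> is_category C \<and> locally_small U C \<and>
     (\<exists>\<kappa> :: 'u rel. reg_card \<kappa> \<and>
        (\<forall>I r D \<delta>. card_directed_poset \<kappa> I r \<and> diagram C I r D \<delta> \<longrightarrow>
           (\<exists>L l. colimit C I r D \<delta> L l)) \<and>
        (\<exists>S. small U S \<and> (\<forall>X \<in> S. presentable \<kappa> C X) \<and>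
           (\<forall>X \<in> Obj C. \<exists>I r D \<delta> l. card_directed_poset \<kappa> I r \<and> diagram C I r D \<delta> \<and>
              D ` I \<subseteq> S \<and> colimit C I r D \<delta> X l)))"

section \<open>AECats, extensions and Galois types\<close>

text \<open>The full subcategory \<open>\<M>\<close> is given by its set of objects \<open>Mod\<close>, the models.\<close>

definition AECat :: "'u itself \<Rightarrow> ('o, 'a) category \<Rightarrow> 'o set \<Rightarrow> bool" where
  "AECat U C Mod \<longleftrightarrow>
     accessible U C \<and> Mod \<subseteq> Obj C \<and> accessible U (full_sub C Mod) \<and>
     (\<forall>(I :: 'u set) r D \<delta>. directed_poset I r \<and> diagram (full_sub C Mod) I r D \<delta> \<longrightarrow>
        (\<exists>L l. colimit (full_sub C Mod) I r D \<delta> L l) \<and>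
        (\<forall>L l. colimit (full_sub C Mod) I r D \<delta> L l \<longrightarrow> colimit C I r D \<delta> L l)) \<and>
     (\<forall>f \<in> Arr C. mono_arr C f)"

definition amalgamation :: "('o, 'a) category \<Rightarrow> 'o set \<Rightarrow> bool" where
  "amalgamation C Mod \<longleftrightarrow>
     (\<forall>M \<in> Mod. \<forall>M1 \<in> Mod. \<forall>M2 \<in> Mod. \<forall>f1 \<in> hom C M M1. \<forall>f2 \<in> hom C M M2.
        \<exists>N \<in> Mod. \<exists>g1 \<in> hom C M1 N. \<exists>g2 \<in> hom C M2 N. g1 \<cdot>\<^bsub>C\<^esub> f1 = g2 \<cdot>\<^bsub>C\<^esub> f2)"

definition into :: "('o, 'a) category \<Rightarrow> 'o \<Rightarrow> 'a \<Rightarrow> bool" where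
  "into C M a \<longleftrightarrow> a \<in> Arr C \<and> Cod C a = M"

definition extension :: "('o, 'a) category \<Rightarrow> 'o set \<Rightarrow> 'o \<Rightarrow> 'o \<Rightarrow> 'a \<Rightarrow> bool" where
  "extension C Mod M N f \<longleftrightarrow> M \<in> Mod \<and> N \<in> Mod \<and> f \<in> hom C M N"

text \<open>Equality \<open>gtp(as; M) = gtp(as'; M')\<close> for finite tuples of arrows.\<close>

definition gtp_eq ::
  "('o, 'a) category \<Rightarrow> 'o set \<Rightarrow> 'a list \<Rightarrow> 'o \<Rightarrow> 'a list \<Rightarrow> 'o \<Rightarrow> bool" where
  "gtp_eq C Mod as M as' M' \<longleftrightarrow>
     (\<forall>a \<in> set as. into C M a) \<and> (\<forall>a \<in> set as'. into C M' a) \<and>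
     map (Dom C) as = map (Dom C) as' \<and>
     (\<exists>N f f'. extension C Mod M N f \<and> extension C Mod M' N f' \<and>
        map (\<lambda>a. f \<cdot>\<^bsub>C\<^esub> a) as = map (\<lambda>a. f' \<cdot>\<^bsub>C\<^esub> a) as')"

section \<open>Independence relations\<close>

text \<open>
  All arrows being monic, subobjects of \<open>M\<close> are represented by arrows into \<open>M\<close>; \<open>factors C a b\<close> is
  the order on them, and mutual factoring is equality of subobjects.
\<close>

definition factors :: "('o, 'a) category \<Rightarrow> 'a \<Rightarrow> 'a \<Rightarrow> bool" where
  "factors C a b \<longleftrightarrow> (\<exists>u \<in> hom C (Dom C a) (Dom C b). b \<cdot>\<^bsub>C\<^esub> u = a)"

definition same_subobject :: "('o, 'a) category \<Rightarrow> 'a \<Rightarrow> 'a \<Rightarrow> bool" where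
  "same_subobject C a b \<longleftrightarrow> factors C a b \<and> factors C b a"

text \<open>
  \<open>indep M a c b\<close> stands for independence of \<open>a\<close> and \<open>b\<close> over \<open>c\<close> in \<open>M\<close>. Being a relation between
  subobjects, it does not depend on the representing arrows.
\<close>

type_synonym ('o, 'a) indep_rel = "'o \<Rightarrow> 'a \<Rightarrow> 'a \<Rightarrow> 'a \<Rightarrow> bool"

definition independence_relation ::
  "('o, 'a) category \<Rightarrow> 'o set \<Rightarrow> 'o set \<Rightarrow> ('o, 'a) indep_rel \<Rightarrow> bool" where
  "independence_relation C Mod base indep \<longleftrightarrow>
     Mod \<subseteq> base \<and> base \<subseteq> Obj C \<and>
     (\<forall>M a c b. indep M a c b \<longrightarrow>
        M \<in> Mod \<and> into C M a \<and> into C M c \<and> into C M b \<and> Dom C c \<in> base) \<and>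
     (\<forall>M a c b a' c' b'. indep M a c b \<and> into C M a' \<and> into C M c' \<and> into C M b' \<and>
        same_subobject C a a' \<and> same_subobject C c c' \<and> same_subobject C b b' \<longrightarrow>
        indep M a' c' b')"

definition ind_invariance where
  "ind_invariance C Mod indep \<longleftrightarrow>
     (\<forall>M a b c M' a' b' c'. indep M a c b \<and> gtp_eq C Mod [a, b, c] M [a', b', c'] M' \<longrightarrow>
        indep M' a' c' b')"

definition ind_monotonicity where
  "ind_monotonicity C Mod indep \<longleftrightarrow>
     (\<forall>M a b c a'. indep M a c b \<and> into C M a' \<and> factors C a' a \<longrightarrow> indep M a' c b)"

definition ind_transitivity where
  "ind_transitivity C Mod indep \<longleftrightarrow>
     (\<forall>M a b c d. indep M a b c \<and> indep M a c d \<and> factors C b c \<longrightarrow> indep M a b d)"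

definition ind_symmetry where
  "ind_symmetry indep \<longleftrightarrow> (\<forall>M a b c. indep M a c b \<longrightarrow> indep M b c a)"

definition ind_existence where
  "ind_existence C Mod base indep \<longleftrightarrow>
     (\<forall>M \<in> Mod. \<forall>a c. into C M a \<and> into C M c \<and> Dom C c \<in> base \<longrightarrow> indep M a c c)"

definition ind_extension where
  "ind_extension C Mod indep \<longleftrightarrow>
     (\<forall>M a b c b'. indep M a c b \<and> into C M b' \<and> factors C b b' \<longrightarrow>
        (\<exists>N f a'. extension C Mod M N f \<and>
           gtp_eq C Mod [a', f \<cdot>\<^bsub>C\<^esub> b, f \<cdot>\<^bsub>C\<^esub> c] N [a, b, c] M \<and>
           indep N a' (f \<cdot>\<^bsub>C\<^esub> c) (f \<cdot>\<^bsub>C\<^esub> b')))"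

text \<open>The arrow \<open>b\<close> below is the one induced by the cocone \<open>m\<close>; it represents the subobject \<open>B\<close>.\<close>

definition ind_union :: "'u itself \<Rightarrow> ('o, 'a) category \<Rightarrow> 'o set \<Rightarrow> ('o, 'a) indep_rel \<Rightarrow> bool" where
  "ind_union U C Mod indep \<longleftrightarrow>
     (\<forall>(I :: 'u set) r D \<delta> M m B \<beta> b a c.
        directed_poset I r \<and> diagram C I r D \<delta> \<and> M \<in> Mod \<and> cocone C I r D \<delta> M m \<and>
        colimit C I r D \<delta> B \<beta> \<and> b \<in> hom C B M \<and> (\<forall>i \<in> I. b \<cdot>\<^bsub>C\<^esub> \<beta> i = m i) \<and>
        (\<forall>i \<in> I. indep M a c (m i)) \<longrightarrow> indep M a c b)"

definition basic_without_union ::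
  "('o, 'a) category \<Rightarrow> 'o set \<Rightarrow> 'o set \<Rightarrow> ('o, 'a) indep_rel \<Rightarrow> bool" where
  "basic_without_union C Mod base indep \<longleftrightarrow>
     independence_relation C Mod base indep \<and>
     ind_invariance C Mod indep \<and> ind_monotonicity C Mod indep \<and>
     ind_transitivity C Mod indep \<and> ind_symmetry indep \<and>
     ind_existence C Mod base indep \<and> ind_extension C Mod indep"

definition basic ::
  "'u itself \<Rightarrow> ('o, 'a) category \<Rightarrow> 'o set \<Rightarrow> 'o set \<Rightarrow> ('o, 'a) indep_rel \<Rightarrow> bool" where
  "basic U C Mod base indep \<longleftrightarrow>
     basic_without_union C Mod base indep \<and> ind_union U C Mod indep"

section \<open>Club Local Character\<close>

text \<open>All arrows representing elements of the poset of subobjects; presentability is taken in \<open>\<M>\<close>.\<close>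

definition Sub_Mod :: "'u rel \<Rightarrow> ('o, 'a) category \<Rightarrow> 'o set \<Rightarrow> 'o \<Rightarrow> 'a set" where
  "Sub_Mod \<kappa> C Mod M =
     {m. into (full_sub C Mod) M m \<and> presentable \<kappa> (full_sub C Mod) (Dom C m)}"

text \<open>
  A set of subobjects is a set \<open>F\<close> of arrows closed under equality of subobjects. In the last clause
  \<open>m\<close> enumerates a chain in \<open>F\<close>, \<open>\<delta>\<close> consists of the inclusions between its members, and \<open>u\<close> is the
  induced arrow from their colimit \<open>L\<close> to \<open>M\<close>.
\<close>

definition club :: "'u rel \<Rightarrow> ('o, 'a) category \<Rightarrow> 'o set \<Rightarrow> 'o \<Rightarrow> 'a set \<Rightarrow> bool" where
  "club \<kappa> C Mod M F \<longleftrightarrow>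
     F \<noteq> {} \<and> F \<subseteq> Sub_Mod \<kappa> C Mod M \<and>
     (\<forall>m \<in> F. \<forall>m' \<in> Sub_Mod \<kappa> C Mod M. same_subobject C m m' \<longrightarrow> m' \<in> F) \<and>
     (\<forall>m \<in> Sub_Mod \<kappa> C Mod M. \<exists>m' \<in> F. factors C m m') \<and>
     (\<forall>(\<theta> :: 'u rel) m \<delta> L l u.
        reg_card \<theta> \<and> \<theta> <o \<kappa> \<and> (\<forall>i \<in> Field \<theta>. m i \<in> F) \<and>
        diagram (full_sub C Mod) (Field \<theta>) \<theta> (\<lambda>i. Dom C (m i)) \<delta> \<and>
        cocone (full_sub C Mod) (Field \<theta>) \<theta> (\<lambda>i. Dom C (m i)) \<delta> M m \<and>
        colimit (full_sub C Mod) (Field \<theta>) \<theta> (\<lambda>i. Dom C (m i)) \<delta> L l \<and>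
        u \<in> hom C L M \<and> (\<forall>i \<in> Field \<theta>. u \<cdot>\<^bsub>C\<^esub> l i = m i) \<longrightarrow>
        u \<in> F)"

definition club_local_character ::
  "'u itself \<Rightarrow> ('o, 'a) category \<Rightarrow> 'o set \<Rightarrow> ('o, 'a) indep_rel \<Rightarrow> bool" where
  "club_local_character U C Mod indep \<longleftrightarrow>
     (\<forall>\<mu> :: 'u rel. reg_card \<mu> \<longrightarrow>
        (\<exists>\<Upsilon> :: 'u rel. reg_card \<Upsilon> \<and>
           (\<forall>\<kappa> :: 'u rel. reg_card \<kappa> \<and> \<Upsilon> \<le>o \<kappa> \<longrightarrow>
              (\<forall>N M a m. N \<in> Mod \<and> into C N a \<and> presentable \<mu> C (Dom C a) \<and>
                 M \<in> Mod \<and> m \<in> hom C M N \<longrightarrow>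
                 (\<exists>F. club \<kappa> C Mod M F \<and> (\<forall>m0 \<in> F. indep N a (m \<cdot>\<^bsub>C\<^esub> m0) m))))))"

section \<open>Dividing\<close>

text \<open>
  Sequences of length \<open>\<mu>\<close> are indexed by \<open>Field \<mu>\<close>, ordered by \<open>\<mu>\<close>; \<open>wo_rel.suc \<mu> {i}\<close> is the
  successor of \<open>i\<close>.
\<close>

definition limit_element :: "'u rel \<Rightarrow> 'u \<Rightarrow> bool" where
  "limit_element \<mu> k \<longleftrightarrow> k \<in> Field \<mu> \<and> underS \<mu> k \<noteq> {} \<and>
     (\<forall>i \<in> underS \<mu> k. wo_rel.suc \<mu> {i} \<in> underS \<mu> k)"

definition chain_of_initial_segments ::
  "('o, 'a) category \<Rightarrow> 'o set \<Rightarrow> 'u rel \<Rightarrow> ('u \<Rightarrow> 'a) \<Rightarrow> 'o \<Rightarrow>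
   ('u \<Rightarrow> 'o) \<Rightarrow> ('u \<Rightarrow> 'u \<Rightarrow> 'a) \<Rightarrow> ('u \<Rightarrow> 'a) \<Rightarrow> bool" where
  "chain_of_initial_segments C Mod \<mu> b N M \<delta> m \<longleftrightarrow>
     N \<in> Mod \<and> (\<exists>X. \<forall>i \<in> Field \<mu>. b i \<in> hom C X N) \<and>
     diagram (full_sub C Mod) (Field \<mu>) \<mu> M \<delta> \<and>
     (\<forall>k. limit_element \<mu> k \<longrightarrow>
        colimit (full_sub C Mod) (underS \<mu> k) \<mu> M \<delta> (M k) (\<lambda>i. \<delta> i k)) \<and>
     cocone (full_sub C Mod) (Field \<mu>) \<mu> M \<delta> N m \<and>
     (\<forall>i \<in> Field \<mu>. factors C (b i) (m (wo_rel.suc \<mu> {i})))"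

definition isi_sequence ::
  "('o, 'a) category \<Rightarrow> 'o set \<Rightarrow> 'u rel \<Rightarrow> ('u \<Rightarrow> 'a) \<Rightarrow> 'o \<Rightarrow> 'a \<Rightarrow> bool" where
  "isi_sequence C Mod \<mu> b N c \<longleftrightarrow>
     (\<exists>M \<delta> m. chain_of_initial_segments C Mod \<mu> b N M \<delta> m \<and>
        into C N c \<and> factors C c (m (wo_rel.minim \<mu> (Field \<mu>))) \<and>
        (\<forall>i j. (i, j) \<in> \<mu> \<longrightarrow> gtp_eq C Mod [b i, m i] N [b j, m i] N))"

text \<open>Here \<open>f : M \<rightarrow> N\<close> is the extension in which the sequence \<open>bs\<close> lives.\<close>

definition consistent_for ::
  "('o, 'a) category \<Rightarrow> 'o set \<Rightarrow> 'a \<Rightarrow> 'a \<Rightarrow> 'a \<Rightarrow> 'o \<Rightarrow> 'o \<Rightarrow> 'a \<Rightarrow> 'i set \<Rightarrow> ('i \<Rightarrow> 'a) \<Rightarrow> bool" where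
  "consistent_for C Mod a b c M N f I bs \<longleftrightarrow>
     (\<exists>N' g a'. extension C Mod N N' g \<and> into C N' a' \<and>
        (\<forall>i \<in> I. gtp_eq C Mod [a', g \<cdot>\<^bsub>C\<^esub> bs i, g \<cdot>\<^bsub>C\<^esub> (f \<cdot>\<^bsub>C\<^esub> c)] N' [a, b, c] M))"

text \<open>
  The shape common to long dividing and isi-dividing; \<open>P \<nu> bs N c\<close> is the requirement on the
  sequences, with \<open>c\<close> already moved to \<open>N\<close>.
\<close>

definition divides_along ::
  "('u rel \<Rightarrow> ('u \<Rightarrow> 'a) \<Rightarrow> 'o \<Rightarrow> 'a \<Rightarrow> bool) \<Rightarrow>
   ('o, 'a) category \<Rightarrow> 'o set \<Rightarrow> 'a \<Rightarrow> 'a \<Rightarrow> 'a \<Rightarrow> 'o \<Rightarrow> bool" where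
  "divides_along P C Mod a b c M \<longleftrightarrow>
     (\<exists>\<mu> :: 'u rel. reg_card \<mu> \<and>
        (\<forall>\<nu> :: 'u rel. reg_card \<nu> \<and> \<mu> \<le>o \<nu> \<longrightarrow>
           (\<exists>N f bs. extension C Mod M N f \<and>
              (\<forall>i \<in> Field \<nu>. gtp_eq C Mod [bs i, f \<cdot>\<^bsub>C\<^esub> c] N [b, c] M) \<and>
              P \<nu> bs N (f \<cdot>\<^bsub>C\<^esub> c) \<and>
              (\<exists>\<kappa> :: 'u rel. reg_card \<kappa> \<and> \<kappa> <o \<nu> \<and>
                 (\<forall>I. I \<subseteq> Field \<nu> \<and> |I| =o \<kappa> \<longrightarrow>
                    \<not> consistent_for C Mod a b c M N f I bs)))))"

definition long_divides ::
  "'u itself \<Rightarrow> ('o, 'a) category \<Rightarrow> 'o set \<Rightarrow> 'a \<Rightarrow> 'a \<Rightarrow> 'a \<Rightarrow> 'o \<Rightarrow> bool" where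
  "long_divides U C Mod a b c M \<longleftrightarrow>
     divides_along (\<lambda>(\<nu> :: 'u rel) bs N c'. True) C Mod a b c M"

definition isi_divides ::
  "'u itself \<Rightarrow> ('o, 'a) category \<Rightarrow> 'o set \<Rightarrow> 'a \<Rightarrow> 'a \<Rightarrow> 'a \<Rightarrow> 'o \<Rightarrow> bool" where
  "isi_divides U C Mod a b c M \<longleftrightarrow>
     divides_along (\<lambda>(\<nu> :: 'u rel) bs N c'. isi_sequence C Mod \<nu> bs N c') C Mod a b c M"

definition ld_indep :: "'u itself \<Rightarrow> ('o, 'a) category \<Rightarrow> 'o set \<Rightarrow> ('o, 'a) indep_rel" where
  "ld_indep U C Mod M a c b \<longleftrightarrow> M \<in> Mod \<and> into C M a \<and> into C M c \<and> into C M b \<and>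
     \<not> long_divides U C Mod a b c M"

definition isi_d_indep :: "'u itself \<Rightarrow> ('o, 'a) category \<Rightarrow> 'o set \<Rightarrow> ('o, 'a) indep_rel" where
  "isi_d_indep U C Mod M a c b \<longleftrightarrow> M \<in> Mod \<and> into C M a \<and> into C M c \<and> into C M b \<and>
     \<not> isi_divides U C Mod a b c M"

end

theory Submission
  imports Defs
begin

text \<open>
  Over \<open>c\<close>, Extension (with Union at limit stages, if an isi-sequence is wanted) yields arbitrarily long
  chains of models \<open>m i\<close> and realisations \<open>bs i \<le> m (i + 1)\<close> of \<open>gtp(b, c)\<close> with \<open>bs i\<close> independent of
  \<open>m i\<close> over \<open>c\<close>. If \<open>gtp(a, b, c; M)\<close> does not divide, some \<open>a'\<close> realises it simultaneously for \<open>\<kappa>\<close> many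
  \<open>bs i\<close>, where \<open>\<kappa>\<close> is large enough for Club Local Character of \<open>a'\<close> and for \<open>M\<close> to be
  \<open>\<kappa>\<close>-presentable. Let \<open>L\<close> be the colimit of these \<open>\<kappa>\<close> many stages. There is a \<open>\<kappa>\<close>-presentable
  \<open>m\<^sub>0 \<le> L\<close> above \<open>M\<close> with \<open>a'\<close> independent of \<open>L\<close> over \<open>m\<^sub>0\<close>, and \<open>m\<^sub>0 \<le> m i\<close> for one of these \<open>i\<close>. So
  \<open>bs i\<close> is independent of \<open>m\<^sub>0\<close> over \<open>c\<close> and of \<open>a'\<close> over \<open>m\<^sub>0\<close>, and Transitivity and Invariance apply.
\<close>

section \<open>Regular cardinals\<close>

text \<open>Failure of dividing controls how many of the \<open>bs i\<close> are realised together,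
  never which ones, and only at some length \<nu>. Hence \<kappa> is fixed beforehand, from the
  domain of \<open>a\<close> and from \<open>M\<close>, which neither the sequence nor
  \<open>a'\<close> can change. The set of indices obtained, of which only the size is known, is
  thinned to a chain of order type \<kappa>; regularity makes this chain \<kappa>-directed, and that
  is what lets the \<kappa>-presentable \<open>m\<^sub>0\<close> drop below a single stage. The isi
  case has a further obstacle: \<open>bs i\<close> and \<open>bs j\<close> must have the same type
  over \<open>m i\<close>, whereas fresh realisations chosen stage by stage agree over
  \<open>c\<close> only. So one realisation is carried along the whole chain: a successor step makes
  its image independent of the next model, and at a limit stage it is the common image of the
  earlier ones in a colimit.\<close>

lemma reg_card_above:
  assumes "universe (U :: 'u itself)" "small U (A :: 'u set)"
  shows "\<exists>\<kappa> :: 'u rel. reg_card \<kappa> \<and> |A| <o \<kappa>"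
proof -
  have nat_less: "|UNIV :: nat set| <o |UNIV :: 'u set|"
    using assms(1) card_of_nat ordIso_ordLess_trans unfolding universe_def by blast
  then obtain f :: "nat \<Rightarrow> 'u" where f: "inj f"
    using card_of_ordLeq[of "UNIV :: nat set" "UNIV :: 'u set"] ordLess_imp_ordLeq by auto
  have inf_U: "\<not> finite (UNIV :: 'u set)"
    using f finite_subset[OF subset_UNIV[of "range f"]] infinite_UNIV_nat finite_imageD by blast
  \<comment> \<open>The copy of the natural numbers makes \<open>B\<close> infinite even if
    \<open>A\<close> is finite, so that the successor cardinal of \<open>B\<close> is infinite and
    regular.\<close>
  define B where "B = A \<union> range f"
  have "|range f| <o |UNIV :: 'u set|"
    using card_of_image ordLeq_ordLess_trans nat_less by blast
  then have B_less: "|B| <o |UNIV :: 'u set|"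
    unfolding B_def using assms(2) inf_U card_of_Un_ordLess_infinite unfolding small_def by blast
  have B_inf: "\<not> finite B"
    unfolding B_def using f infinite_UNIV_nat finite_imageD by blast
  let ?s = "cardSuc |B|"
  have s: "Card_order ?s" "cinfinite ?s" "|B| <o ?s"
    unfolding cinfinite_def cardSuc_finite[OF card_of_Card_order] Field_card_of
    using B_inf by (simp_all add: cardSuc_Card_order cardSuc_greater card_of_Card_order)
  have reg: "regularCard ?s"
    using infinite_cardSuc_regularCard[OF _ card_of_Card_order] B_inf by (simp add: Field_card_of)
  \<comment> \<open>Closure of the universe under power sets keeps the successor small.\<close>
  have "?s \<le>o |Pow B|"
    by (simp add: cardSuc_least card_of_Card_order card_of_Pow)
  moreover have "|Pow B| <o |UNIV :: 'u set|"
    using assms(1) B_less unfolding universe_def small_def by blast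
  ultimately have s_less: "?s <o |UNIV :: 'u set|"
    using ordLeq_ordLess_trans by blast
  \<comment> \<open>\<open>cardSuc\<close> produces a relation on sets, but a
    \<open>reg_card\<close> has to live on \<open>'u\<close>. Being below the size of
    \<open>'u\<close>, it has a copy \<open>|Z|\<close> there.\<close>
  have Field_s: "|Field ?s| =o ?s"
    using card_of_Field_ordIso[OF s(1)] .
  have "|Field ?s| \<le>o |UNIV :: 'u set|"
    using ordIso_ordLeq_trans[OF Field_s ordLess_imp_ordLeq[OF s_less]] .
  then obtain Z :: "'u set" where "|Field ?s| =o |Z|"
    unfolding internalize_card_of_ordLeq2[of "Field ?s" "UNIV :: 'u set"] by auto
  then have Z: "?s =o |Z|"
    by (rule ordIso_transitive[OF ordIso_symmetric[OF Field_s]])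
  have "|Z| <o |UNIV :: 'u set|"
    using ordIso_ordLess_trans[OF ordIso_symmetric[OF Z] s_less] .
  moreover have "Cinfinite |Z|"
    using Cinfinite_cong[OF Z] s(1,2) by blast
  moreover have "regularCard |Z|"
    using regularCard_ordIso[OF Z] s(1,2) reg by blast
  ultimately have "reg_card |Z|"
    unfolding reg_card_def by blast
  moreover have "|A| <o |Z|"
    using ordLess_ordIso_trans[OF ordLeq_ordLess_trans[OF card_of_mono1 s(3)] Z]
    unfolding B_def by blast
  ultimately show ?thesis by blast
qed

lemma small_subset: "small U B \<Longrightarrow> A \<subseteq> B \<Longrightarrow> small U A"
  unfolding small_def using card_of_mono1 ordLeq_ordLess_trans by blast

context
  fixes \<kappa> :: "'u rel"
  assumes reg: "reg_card \<kappa>"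
begin

lemma reg_card_Well_order: "Well_order \<kappa>"
  using reg card_order_on_well_order_on unfolding reg_card_def by blast

lemma reg_card_wo: "wo_rel \<kappa>"
  using reg_card_Well_order unfolding wo_rel_def .

lemma reg_card_refl: "i \<in> Field \<kappa> \<Longrightarrow> (i, i) \<in> \<kappa>"
  using wo_rel.REFL[OF reg_card_wo] by (auto simp: refl_on_def)

lemma reg_card_trans: "(i, j) \<in> \<kappa> \<Longrightarrow> (j, k) \<in> \<kappa> \<Longrightarrow> (i, k) \<in> \<kappa>"
  using wo_rel.TRANS[OF reg_card_wo] by (auto dest: transD)

lemma reg_card_antisym: "(i, j) \<in> \<kappa> \<Longrightarrow> (j, i) \<in> \<kappa> \<Longrightarrow> i = j"
  using wo_rel.ANTISYM[OF reg_card_wo] by (auto dest: antisymD)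

lemma reg_card_total: "i \<in> Field \<kappa> \<Longrightarrow> j \<in> Field \<kappa> \<Longrightarrow> (i, j) \<in> \<kappa> \<or> (j, i) \<in> \<kappa>"
  using wo_rel.TOTALS[OF reg_card_wo] by auto

lemma reg_card_Field: "(i, j) \<in> \<kappa> \<Longrightarrow> i \<in> Field \<kappa> \<and> j \<in> Field \<kappa>"
  by (auto simp: Field_def)

lemma reg_card_small: "small TYPE('u) (Field \<kappa>)"
  using reg card_of_Field_ordIso ordIso_ordLess_trans unfolding reg_card_def small_def by blast

lemma reg_card_Field_nonempty: "Field \<kappa> \<noteq> {}"
  using reg unfolding reg_card_def cinfinite_def by auto

lemma reg_card_Restr_partial_order:
  "I \<subseteq> Field \<kappa> \<Longrightarrow> partial_order_on I (Restr \<kappa> I)"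
  using reg_card_refl reg_card_trans reg_card_antisym
  unfolding partial_order_on_def preorder_on_def
  by (auto simp: refl_on_def trans_def antisym_def)

lemma reg_card_Restr_directed:
  assumes "I \<subseteq> Field \<kappa>" "I \<noteq> {}"
  shows "directed_poset I (Restr \<kappa> I)"
proof -
  have "\<exists>k\<in>I. (i, k) \<in> Restr \<kappa> I \<and> (j, k) \<in> Restr \<kappa> I" if "i \<in> I" "j \<in> I" for i j
    using reg_card_total[of i j] reg_card_refl[of i] reg_card_refl[of j] that assms by auto
  then show ?thesis
    unfolding directed_poset_def
    using assms reg_card_Restr_partial_order small_subset[OF reg_card_small] by auto
qed

text \<open>Regularity: fewer than \<kappa> elements are never cofinal, and by totality an element
  that none of them exceeds is an upper bound. This makes presentability applicable along chains of
  length \<kappa>.\<close>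

lemma reg_card_card_directed: "card_directed_poset \<kappa> (Field \<kappa>) \<kappa>"
proof -
  have "\<exists>k\<in>Field \<kappa>. \<forall>i\<in>K. (i, k) \<in> \<kappa>" if "K \<subseteq> Field \<kappa>" "|K| <o \<kappa>" for K
  proof -
    have "\<not> cofinal K \<kappa>"
      using that reg unfolding reg_card_def regularCard_def by (metis not_ordLess_ordIso)
    then obtain k where "k \<in> Field \<kappa>" "\<forall>b\<in>K. k = b \<or> (k, b) \<notin> \<kappa>"
      unfolding cofinal_def by auto
    moreover from this have "(b, k) \<in> \<kappa>" if "b \<in> K" for b
      using that \<open>K \<subseteq> Field \<kappa>\<close> reg_card_total[of b k] by (metis subsetD)
    ultimately show ?thesis by blast
  qed
  moreover have "Restr \<kappa> (Field \<kappa>) = \<kappa>" by (auto simp: Field_def)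
  ultimately show ?thesis
    unfolding card_directed_poset_def
    using reg_card_small reg_card_Restr_partial_order[of "Field \<kappa>"] by auto
qed

text \<open>An infinite cardinal has no last element. \<open>wo_rel.suc\<close> is meaningful only
  where a strict upper bound exists, so the facts on successors rest on this.\<close>

lemma reg_card_AboveS:
  assumes "i \<in> Field \<kappa>"
  shows "AboveS \<kappa> {i} \<noteq> {}"
proof -
  have "Field \<kappa> \<noteq> under \<kappa> i"
    using Card_order_infinite_not_under reg unfolding reg_card_def cinfinite_def by blast
  then obtain j where "j \<in> Field \<kappa>" "j \<notin> under \<kappa> i"
    using under_Field[of \<kappa> i] by auto
  then have "j \<in> AboveS \<kappa> {i}"
    using assms reg_card_total[of i j] reg_card_refl[of i] unfolding AboveS_def under_def by auto
  then show ?thesis by auto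
qed

lemma reg_card_suc:
  assumes "i \<in> Field \<kappa>"
  shows "(i, wo_rel.suc \<kappa> {i}) \<in> \<kappa>" "wo_rel.suc \<kappa> {i} \<noteq> i"
    "wo_rel.suc \<kappa> {i} \<in> Field \<kappa>"
  using wo_rel.suc_greater[OF reg_card_wo _ reg_card_AboveS[OF assms], of i]
    wo_rel.suc_inField[OF reg_card_wo _ reg_card_AboveS[OF assms]] assms by auto

lemma reg_card_suc_least:
  assumes "(i, j) \<in> \<kappa>" "i \<noteq> j"
  shows "(wo_rel.suc \<kappa> {i}, j) \<in> \<kappa>"
  using wo_rel.suc_least_AboveS[OF reg_card_wo, of j "{i}"] assms reg_card_Field[OF assms(1)]
  unfolding AboveS_def by auto

lemma reg_card_suc_inj:
  assumes "i \<in> Field \<kappa>" "j \<in> Field \<kappa>" "wo_rel.suc \<kappa> {i} = wo_rel.suc \<kappa> {j}"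
  shows "i = j"
proof (rule ccontr)
  assume "i \<noteq> j"
  then consider "(wo_rel.suc \<kappa> {i}, j) \<in> \<kappa>" | "(wo_rel.suc \<kappa> {j}, i) \<in> \<kappa>"
    using reg_card_total[OF assms(1,2)] reg_card_suc_least[of i j] reg_card_suc_least[of j i] by auto
  then show False
    using reg_card_suc(1,2)[OF assms(1)] reg_card_suc(1,2)[OF assms(2)] assms(3)
      reg_card_antisym by cases metis+
qed

lemma reg_card_minim:
  assumes "i \<in> Field \<kappa>"
  shows "(wo_rel.minim \<kappa> (Field \<kappa>), i) \<in> \<kappa>"
  using wo_rel.minim_least[OF reg_card_wo _ assms] by auto

lemma reg_card_cases:
  assumes "k \<in> Field \<kappa>"
  obtains "k = wo_rel.minim \<kappa> (Field \<kappa>)" "underS \<kappa> k = {}"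
  | i where "i \<in> Field \<kappa>" "k = wo_rel.suc \<kappa> {i}"
  | "limit_element \<kappa> k"
proof -
  consider "underS \<kappa> k = {}" | "underS \<kappa> k \<noteq> {}" "\<not> limit_element \<kappa> k" | "limit_element \<kappa> k"
    by blast
  then show ?thesis
  proof cases
    case 1
    then have "k = wo_rel.minim \<kappa> (Field \<kappa>)"
      using reg_card_minim[OF assms] unfolding underS_def by auto
    then show ?thesis using that 1 by blast
  next
    case 2
    then obtain i where "i \<in> underS \<kappa> k" "wo_rel.suc \<kappa> {i} \<notin> underS \<kappa> k"
      using assms unfolding limit_element_def by blast
    then have "i \<in> Field \<kappa>" "k = wo_rel.suc \<kappa> {i}"
      using reg_card_suc_least[of i k] reg_card_Field unfolding underS_def by auto
    then show ?thesis using that by blast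
  qed (use that in blast)
qed

end

text \<open>Cardinals are initial ordinals, so a set of size \<kappa> has order type at least
  \<kappa>; \<open>e\<close> enumerates its initial segment of type \<kappa>. A consistent subfamily
  is known by its size only, and this turns it into a chain of regular length.\<close>

lemma reg_card_embed:
  assumes \<kappa>: "reg_card \<kappa>" and \<nu>: "reg_card \<nu>" and I: "I \<subseteq> Field \<nu>" "|I| =o \<kappa>"
  obtains e where "\<And>i. i \<in> Field \<kappa> \<Longrightarrow> e i \<in> I"
    "\<And>i j. (i, j) \<in> \<kappa> \<Longrightarrow> (e i, e j) \<in> \<nu>"
    "inj_on e (Field \<kappa>)"
proof -
  have W: "well_order_on I (Restr \<nu> I)"
    using well_order_on_Restr[OF reg_card_Well_order[OF \<nu>] I(1)] .
  then have "\<kappa> \<le>o Restr \<nu> I"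
    using card_of_least[OF W] I(2) ordIso_ordLeq_trans ordIso_symmetric by blast
  then obtain e where e: "Well_order \<kappa>" "embed \<kappa> (Restr \<nu> I) e"
    unfolding ordLeq_def by auto
  show thesis
  proof
    show "e i \<in> I" if "i \<in> Field \<kappa>" for i
      using embed_in_Field[OF e(2) that] by (auto simp: Field_def)
    show "(e i, e j) \<in> \<nu>" if "(i, j) \<in> \<kappa>" for i j
      using embed_compat[OF e(2)] that unfolding compat_def by auto
    show "inj_on e (Field \<kappa>)"
      using embed_inj_on e by blast
  qed
qed

section \<open>Colimits and presentability\<close>

locale cat =
  fixes C :: "('o, 'a) category" (structure)
  assumes is_category: "is_category C"
begin

lemma hom_Obj: "f \<in> hom C X Y \<Longrightarrow> X \<in> Obj C \<and> Y \<in> Obj C"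
  using is_category unfolding is_category_def hom_def by blast

lemma id_hom: "X \<in> Obj C \<Longrightarrow> Id C X \<in> hom C X X"
  using is_category unfolding is_category_def by blast

lemma comp_hom: "g \<in> hom C Y Z \<Longrightarrow> f \<in> hom C X Y \<Longrightarrow> g \<cdot> f \<in> hom C X Z"
  using is_category unfolding is_category_def by blast

lemma comp_id: "f \<in> hom C X Y \<Longrightarrow> f \<cdot> Id C X = f"
  using is_category unfolding is_category_def by blast

lemma id_comp: "f \<in> hom C X Y \<Longrightarrow> Id C Y \<cdot> f = f"
  using is_category unfolding is_category_def by blast

lemma comp_assoc:
  "h \<in> hom C Y Z \<Longrightarrow> g \<in> hom C X Y \<Longrightarrow> f \<in> hom C W X \<Longrightarrow> h \<cdot> g \<cdot> f = (h \<cdot> g) \<cdot> f"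
  using is_category unfolding is_category_def by blast

lemma colimit_mediator:
  assumes "colimit C I r D \<delta> L l" "cocone C I r D \<delta> X x"
  obtains u where "u \<in> hom C L X" "\<forall>i\<in>I. u \<cdot> l i = x i"
  using assms unfolding colimit_def by blast

lemma cocone_comp:
  assumes "diagram C I r D \<delta>" "cocone C I r D \<delta> L l" "u \<in> hom C L X"
  shows "cocone C I r D \<delta> X (\<lambda>i. u \<cdot> l i)"
  unfolding cocone_def
proof (intro conjI ballI impI)
  fix i j assume "i \<in> I" "j \<in> I" "(i, j) \<in> r"
  then have "l j \<in> hom C (D j) L" "\<delta> i j \<in> hom C (D i) (D j)" "l j \<cdot> \<delta> i j = l i"
    using assms(1,2) unfolding cocone_def diagram_def by auto
  then show "(u \<cdot> l j) \<cdot> \<delta> i j = u \<cdot> l i"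
    using comp_assoc[OF assms(3)] by metis
qed (use assms(2,3) hom_Obj comp_hom in \<open>auto simp: cocone_def\<close>)

lemma colimit_eqI:
  assumes "diagram C I r D \<delta>" "colimit C I r D \<delta> L l" "u \<in> hom C L X" "v \<in> hom C L X"
    "\<And>i. i \<in> I \<Longrightarrow> u \<cdot> l i = v \<cdot> l i"
  shows "u = v"
proof -
  have "cocone C I r D \<delta> L l" using assms(2) unfolding colimit_def by blast
  then have "cocone C I r D \<delta> X (\<lambda>i. v \<cdot> l i)"
    using cocone_comp assms by blast
  then have "\<exists>!w. w \<in> hom C L X \<and> (\<forall>i\<in>I. w \<cdot> l i = v \<cdot> l i)"
    using assms(2) unfolding colimit_def by blast
  then show ?thesis using assms(3-5) by blast
qed

end

text \<open>\<open>directed_poset\<close> asks for a partial order on the index set itself, whereas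
  chains are indexed by subsets of the field of a cardinal and keep its full order. This lemma and
  the next two translate.\<close>

lemma diagram_Restr: "diagram C I (Restr r I) D \<delta> \<longleftrightarrow> diagram C I r D \<delta>"
  unfolding diagram_def by auto

lemma cocone_Restr: "cocone C I (Restr r I) D \<delta> L l \<longleftrightarrow> cocone C I r D \<delta> L l"
  unfolding cocone_def by auto

lemma colimit_Restr: "colimit C I (Restr r I) D \<delta> L l \<longleftrightarrow> colimit C I r D \<delta> L l"
  unfolding colimit_def cocone_Restr ..

lemma cocone_cong:
  assumes "\<And>i. i \<in> I \<Longrightarrow> D i = D' i" "\<And>i j. i \<in> I \<Longrightarrow> j \<in> I \<Longrightarrow> (i, j) \<in> r \<Longrightarrow> \<delta> i j = \<delta>' i j"
    "\<And>i. i \<in> I \<Longrightarrow> l i = l' i"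
  shows "cocone C I r D \<delta> L l \<longleftrightarrow> cocone C I r D' \<delta>' L l'"
  unfolding cocone_def using assms by auto

lemma colimit_cong:
  assumes "\<And>i. i \<in> I \<Longrightarrow> D i = D' i" "\<And>i j. i \<in> I \<Longrightarrow> j \<in> I \<Longrightarrow> (i, j) \<in> r \<Longrightarrow> \<delta> i j = \<delta>' i j"
    "\<And>i. i \<in> I \<Longrightarrow> l i = l' i"
  shows "colimit C I r D \<delta> L l \<longleftrightarrow> colimit C I r D' \<delta>' L l'"
  unfolding colimit_def using cocone_cong[of I D D' r \<delta> \<delta>'] assms by auto

lemma card_directed_poset_mono:
  "card_directed_poset \<kappa>' I r \<Longrightarrow> \<kappa> \<le>o \<kappa>' \<Longrightarrow> card_directed_poset \<kappa> I r"
  unfolding card_directed_poset_def using ordLess_ordLeq_trans by blast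

text \<open>A larger cardinal asks more of the directed posets and so leaves fewer colimits to
  test.\<close>

lemma presentable_mono:
  fixes \<kappa> \<kappa>' :: "'u rel"
  assumes "presentable \<kappa> C X" "\<kappa> \<le>o \<kappa>'"
  shows "presentable \<kappa>' C X"
proof -
  have "card_directed_poset \<kappa> I r" if "card_directed_poset \<kappa>' I r" for I r
    using card_directed_poset_mono that assms(2) by blast
  then show ?thesis using assms(1) unfolding presentable_def by meson
qed

lemma reg_card_common_bound:
  fixes \<kappa>\<^sub>1 \<kappa>\<^sub>2 :: "'u rel"
  assumes "reg_card \<kappa>\<^sub>1" "reg_card \<kappa>\<^sub>2"
  obtains \<kappa> :: "'u rel" where "reg_card \<kappa>" "\<kappa>\<^sub>1 \<le>o \<kappa>" "\<kappa>\<^sub>2 \<le>o \<kappa>"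
proof -
  have W: "Well_order \<kappa>\<^sub>1" "Well_order \<kappa>\<^sub>2"
    using assms by (auto intro: reg_card_Well_order)
  consider "\<kappa>\<^sub>1 \<le>o \<kappa>\<^sub>2" | "\<kappa>\<^sub>2 \<le>o \<kappa>\<^sub>1"
    using ordLeq_total[OF W] by auto
  then show thesis
    using that assms ordLeq_reflexive[OF W(1)] ordLeq_reflexive[OF W(2)] by cases auto
qed

lemma mono_cancel:
  assumes "\<And>f. f \<in> Arr C \<Longrightarrow> mono_arr C f" "e \<in> hom C Y Z" "g \<in> hom C X Y" "h \<in> hom C X Y"
    "e \<cdot>\<^bsub>C\<^esub> g = e \<cdot>\<^bsub>C\<^esub> h"
  shows "g = h"
  using assms(1)[of e] assms(2-) unfolding mono_arr_def hom_def by auto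

text \<open>When all arrows are monic, the injectivity half of presentability is automatic.\<close>

lemma (in cat) presentableI:
  fixes \<mu> :: "'u rel"
  assumes "\<And>f. f \<in> Arr C \<Longrightarrow> mono_arr C f" "reg_card \<mu>" "X \<in> Obj C"
    "\<And>J r E \<epsilon> L e f. card_directed_poset \<mu> J r \<Longrightarrow> diagram C J r E \<epsilon> \<Longrightarrow>
       colimit C J r E \<epsilon> L e \<Longrightarrow> f \<in> hom C X L \<Longrightarrow> \<exists>j\<in>J. \<exists>g\<in>hom C X (E j). e j \<cdot> g = f"
  shows "presentable \<mu> C X"
  unfolding presentable_def
proof (intro conjI allI impI ballI)
  fix J r E \<epsilon> L e i j g h
  assume H: "card_directed_poset \<mu> J r \<and> diagram C J r E \<epsilon> \<and> colimit C J r E \<epsilon> L e"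
    "i \<in> J" "j \<in> J" "g \<in> hom C X (E i)" "h \<in> hom C X (E j)" "e i \<cdot> g = e j \<cdot> h"
  have "|{i, j}| <o \<mu>"
    using assms(2) finite_ordLess_infinite[of "|{i, j}|" \<mu>] card_of_Well_order[of "{i, j}"]
      reg_card_Well_order[OF assms(2)]
    unfolding reg_card_def cinfinite_def by (simp add: Field_card_of)
  moreover have "{i, j} \<subseteq> J" using H(2,3) by auto
  ultimately obtain k where "k \<in> J" "\<forall>i'\<in>{i, j}. (i', k) \<in> r"
    using H(1) unfolding card_directed_poset_def by meson
  then have k: "k \<in> J" "(i, k) \<in> r" "(j, k) \<in> r" by auto
  have "cocone C J r E \<epsilon> L e"
    using H(1) unfolding colimit_def by blast
  then have e: "e k \<in> hom C (E k) L" "e k \<cdot> \<epsilon> i k = e i" "e k \<cdot> \<epsilon> j k = e j"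
    "\<epsilon> i k \<in> hom C (E i) (E k)" "\<epsilon> j k \<in> hom C (E j) (E k)"
    using H(1-3) k unfolding diagram_def cocone_def by simp_all
  have "e k \<cdot> \<epsilon> i k \<cdot> g = e k \<cdot> \<epsilon> j k \<cdot> h"
    using comp_assoc[OF e(1,4) H(4)] comp_assoc[OF e(1,5) H(5)] e(2,3) H(6) by simp
  then have "\<epsilon> i k \<cdot> g = \<epsilon> j k \<cdot> h"
    using mono_cancel[OF assms(1) e(1) comp_hom[OF e(4) H(4)] comp_hom[OF e(5) H(5)]] by simp
  then show "\<exists>k\<in>J. (i, k) \<in> r \<and> (j, k) \<in> r \<and> \<epsilon> i k \<cdot> g = \<epsilon> j k \<cdot> h"
    using k by blast
qed (use assms(3,4) in blast)+

lemma presentable_factor: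
  assumes "presentable \<kappa> C X" "card_directed_poset \<kappa> I r" "diagram C I r D \<delta>"
    "colimit C I r D \<delta> L l" "f \<in> hom C X L"
  obtains i g where "i \<in> I" "g \<in> hom C X (D i)" "l i \<cdot>\<^bsub>C\<^esub> g = f"
  using assms unfolding presentable_def by blast

text \<open>
  If \<open>X\<close> is a colimit over \<open>I\<close> of \<open>\<kappa>\<close>-presentable objects, any regular \<open>\<mu> \<ge> \<kappa>\<close> with \<open>\<mu> > |I|\<close> will do.
\<close>

lemma accessible_presentable:
  fixes U :: "'u itself" and C :: "('o, 'a) category" (structure)
  assumes univ: "universe U" and acc: "accessible U C"
    and all_mono: "\<And>f. f \<in> Arr C \<Longrightarrow> mono_arr C f" and X: "X \<in> Obj C"
  shows "\<exists>\<mu> :: 'u rel. reg_card \<mu> \<and> presentable \<mu> C X"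
proof -
  interpret cat C using acc unfolding accessible_def cat_def by blast
  obtain \<kappa> :: "'u rel" and S where \<kappa>: "reg_card \<kappa>" "\<forall>X \<in> S. presentable \<kappa> C X"
    "\<forall>X \<in> Obj C. \<exists>(I :: 'u set) r D \<delta> l. card_directed_poset \<kappa> I r \<and> diagram C I r D \<delta> \<and>
              D ` I \<subseteq> S \<and> colimit C I r D \<delta> X l"
    using acc unfolding accessible_def by (elim conjE exE, intro that) assumption+
  from \<kappa>(3) X obtain I :: "'u set" and r D \<delta> l where I: "card_directed_poset \<kappa> I r" "diagram C I r D \<delta>"
    "D ` I \<subseteq> S" "colimit C I r D \<delta> X l"
    by (elim conjE exE ballE[where x = X], intro that) auto
  have "small U I"
    using I(1) unfolding card_directed_poset_def small_def by blast
  then obtain \<mu>\<^sub>1 :: "'u rel" where \<mu>\<^sub>1: "reg_card \<mu>\<^sub>1" "|I| <o \<mu>\<^sub>1"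
    using reg_card_above[OF univ] by blast
  obtain \<mu> :: "'u rel" where \<mu>: "reg_card \<mu>" "\<kappa> \<le>o \<mu>" "\<mu>\<^sub>1 \<le>o \<mu>"
    by (rule reg_card_common_bound[OF \<kappa>(1) \<mu>\<^sub>1(1)])
  have I_less: "|I| <o \<mu>"
    using ordLess_ordLeq_trans[OF \<mu>\<^sub>1(2) \<mu>(3)] .
  have "presentable \<mu> C X"
  proof (rule presentableI[OF all_mono \<mu>(1) X])
    fix J :: "'u set" and r' E \<epsilon> L e f
    assume J: "card_directed_poset \<mu> J r'" "diagram C J r' E \<epsilon>" "colimit C J r' E \<epsilon> L e"
      and f: "f \<in> hom C X L"
    have l: "cocone C I r D \<delta> X l" using I(4) unfolding colimit_def by blast
    have e: "cocone C J r' E \<epsilon> L e" using J(3) unfolding colimit_def by blast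
    have "\<exists>j g. j \<in> J \<and> g \<in> hom C (D i) (E j) \<and> e j \<cdot> g = f \<cdot> l i" if "i \<in> I" for i
    proof -
      have "D i \<in> S" using that I(3) by auto
      then have "presentable \<kappa> C (D i)" using \<kappa>(2) by simp
      then have "presentable \<mu> C (D i)"
        by (rule presentable_mono[OF _ \<mu>(2)])
      moreover have "f \<cdot> l i \<in> hom C (D i) L"
        using that l comp_hom[OF f] unfolding cocone_def by simp
      ultimately show ?thesis
        by (rule presentable_factor[OF _ J]) blast
    qed
    then obtain j g where jg: "\<And>i. i \<in> I \<Longrightarrow> j i \<in> J" "\<And>i. i \<in> I \<Longrightarrow> g i \<in> hom C (D i) (E (j i))"
      "\<And>i. i \<in> I \<Longrightarrow> e (j i) \<cdot> g i = f \<cdot> l i"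
      by metis
    have "|j ` I| <o \<mu>"
      using ordLeq_ordLess_trans[OF card_of_image I_less] .
    moreover have "j ` I \<subseteq> J" using jg(1) by auto
    ultimately obtain k where "k \<in> J" "\<forall>i'\<in>j ` I. (i', k) \<in> r'"
      using J(1) unfolding card_directed_poset_def by meson
    then have k: "k \<in> J" "\<And>i. i \<in> I \<Longrightarrow> (j i, k) \<in> r'" by auto
    \<comment> \<open>\<open>h\<close> gathers all the factorisations at one stage \<open>k\<close>,
      which bounds the fewer than \<mu> stages \<open>j i\<close>.\<close>
    define h where "h i = \<epsilon> (j i) k \<cdot> g i" for i
    have \<epsilon>: "\<epsilon> (j i) k \<in> hom C (E (j i)) (E k)" "e k \<cdot> \<epsilon> (j i) k = e (j i)" if "i \<in> I" for i
      using that J(2) e k jg(1) unfolding diagram_def cocone_def by simp_all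
    have ek: "e k \<in> hom C (E k) L" using e k(1) unfolding cocone_def by blast
    have h: "h i \<in> hom C (D i) (E k)" "e k \<cdot> h i = f \<cdot> l i" if "i \<in> I" for i
      using comp_hom[OF \<epsilon>(1)[OF that] jg(2)[OF that]] jg(3)[OF that] \<epsilon>(2)[OF that]
        comp_assoc[OF ek \<epsilon>(1)[OF that] jg(2)[OF that]] unfolding h_def by simp_all
    \<comment> \<open>Compatibility is checked after composing with the monic \<open>e k\<close>,
      where it becomes that of the cocone \<open>l\<close> followed by \<open>f\<close>.\<close>
    have h_cocone: "cocone C I r D \<delta> (E k) h"
      unfolding cocone_def
    proof (intro conjI ballI impI)
      show "E k \<in> Obj C" using ek hom_Obj by blast
      fix i i' assume ii: "i \<in> I" "i' \<in> I" "(i, i') \<in> r"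
      then have \<delta>: "\<delta> i i' \<in> hom C (D i) (D i')" "l i' \<cdot> \<delta> i i' = l i" "l i' \<in> hom C (D i') X"
        using I(2) l unfolding diagram_def cocone_def by simp_all
      have "e k \<cdot> h i' \<cdot> \<delta> i i' = (f \<cdot> l i') \<cdot> \<delta> i i'"
        using comp_assoc[OF ek h(1) \<delta>(1)] h(2) ii by simp
      also have "\<dots> = e k \<cdot> h i"
        using comp_assoc[OF f \<delta>(3,1)] \<delta>(2) h(2) ii by simp
      finally have "e k \<cdot> h i' \<cdot> \<delta> i i' = e k \<cdot> h i" .
      then show "h i' \<cdot> \<delta> i i' = h i"
        using mono_cancel[OF all_mono ek comp_hom[OF h(1) \<delta>(1)] h(1)] ii by simp
    qed (use h(1) in blast)
    obtain u where u: "u \<in> hom C X (E k)" "\<forall>i\<in>I. u \<cdot> l i = h i"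
      by (rule colimit_mediator[OF I(4) h_cocone])
    have "e k \<cdot> u = f"
    proof (rule colimit_eqI[OF I(2,4)])
      fix i assume i: "i \<in> I"
      then have "l i \<in> hom C (D i) X" using l unfolding cocone_def by blast
      then have "(e k \<cdot> u) \<cdot> l i = e k \<cdot> h i"
        using comp_assoc[OF ek u(1), of "l i" "D i"] u(2) i by simp
      then show "(e k \<cdot> u) \<cdot> l i = f \<cdot> l i" using h(2) i by simp
    qed (use ek u f comp_hom in blast)+
    then show "\<exists>j\<in>J. \<exists>g\<in>hom C X (E j). e j \<cdot> g = f"
      using k u by blast
  qed
  then show ?thesis using \<mu>(1) by blast
qed

section \<open>Continuous chains\<close>

text \<open>
  The arrows into a limit stage only need to be a cocone in \<open>C\<close>; it is their image in \<open>E\<close> under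
  \<open>(F, G)\<close> that has to be a colimit. A stage of the recursion is an object together with the family of
  arrows into it from the earlier stages.
\<close>

lemma (in cat) continuous_chain:
  fixes \<nu> :: "'u rel" and E :: "('p, 'b) category" and F :: "'o \<Rightarrow> 'p" and G :: "'a \<Rightarrow> 'b"
  assumes \<nu>: "reg_card \<nu>" and X0: "X0 \<in> Obj C"
    and step: "\<And>X g. g \<in> hom C X0 X \<Longrightarrow> \<exists>Y s. s \<in> hom C X Y \<and> S g s"
    and colim: "\<And>(I :: 'u set) r X \<delta>. directed_poset I r \<Longrightarrow> diagram C I r X \<delta> \<Longrightarrow>
      \<exists>L l. cocone C I r X \<delta> L l \<and>
        colimit E I r (\<lambda>i. F (X i)) (\<lambda>i j. G (\<delta> i j)) (F L) (\<lambda>i. G (l i))"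
  defines "z \<equiv> wo_rel.minim \<nu> (Field \<nu>)"
  shows "\<exists>X \<delta>. diagram C (Field \<nu>) \<nu> X \<delta> \<and> X z = X0 \<and>
    (\<forall>i\<in>Field \<nu>. S (\<delta> z i) (\<delta> i (wo_rel.suc \<nu> {i}))) \<and>
    (\<forall>k. limit_element \<nu> k \<longrightarrow>
      colimit E (underS \<nu> k) \<nu> (\<lambda>i. F (X i)) (\<lambda>i j. G (\<delta> i j)) (F (X k)) (\<lambda>i. G (\<delta> i k)))"
proof -
  \<comment> \<open>As each stage stores its incoming arrows, the connecting arrow from
    \<open>i\<close> to \<open>j\<close> is \<open>snd (f j) i\<close> and later stages never revise
    earlier data. The guard is there because the recursion ranges over all of \<open>'u\<close>, not
    just over \<open>Field \<nu>\<close>.\<close>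
  define P :: "('u \<Rightarrow> 'o \<times> ('u \<Rightarrow> 'a)) \<Rightarrow> 'u \<Rightarrow> 'o \<times> ('u \<Rightarrow> 'a) \<Rightarrow> bool" where
    "P f k x \<longleftrightarrow> (k \<in> Field \<nu> \<longrightarrow>
      fst x \<in> Obj C \<and> snd x k = Id C (fst x) \<and>
      (\<forall>i\<in>underS \<nu> k. snd x i \<in> hom C (fst (f i)) (fst x)) \<and>
      (\<forall>j\<in>underS \<nu> k. \<forall>i\<in>underS \<nu> k. (i, j) \<in> \<nu> \<longrightarrow> snd x j \<cdot> snd (f j) i = snd x i) \<and>
      (underS \<nu> k = {} \<longrightarrow> fst x = X0) \<and>
      (\<forall>j\<in>underS \<nu> k. wo_rel.suc \<nu> {j} = k \<longrightarrow> S (snd (f j) z) (snd x j)) \<and>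
      (limit_element \<nu> k \<longrightarrow>
        colimit E (underS \<nu> k) \<nu> (\<lambda>i. F (fst (f i))) (\<lambda>i j. G (snd (f j) i))
          (F (fst x)) (\<lambda>i. G (snd x i))))" for f k x
  note wo = reg_card_refl[OF \<nu>] reg_card_trans[OF \<nu>] reg_card_antisym[OF \<nu>]
  have lt: "(i, j) \<in> \<nu> - Relation.Id \<longleftrightarrow> i \<in> underS \<nu> j" for i j
    unfolding underS_def by auto
  have z: "z \<in> Field \<nu>" "\<And>i. i \<in> Field \<nu> \<Longrightarrow> (z, i) \<in> \<nu>" "underS \<nu> z = {}"
    using reg_card_minim[OF \<nu>] reg_card_Field_nonempty[OF \<nu>] reg_card_Field[OF \<nu>] wo(3)
    unfolding z_def underS_def by blast+
  \<comment> \<open>\<open>P\<close> prescribes composites only for strict predecessors; coinciding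
    indices are covered by the identities.\<close>
  have diagram: "diagram C A \<nu> (\<lambda>i. fst (f i)) (\<lambda>i j. snd (f j) i)"
    if A: "A \<subseteq> Field \<nu>" "\<And>y. y \<in> A \<Longrightarrow> P f y (f y)" for f A
  proof -
    have ob: "fst (f i) \<in> Obj C" "snd (f i) i = Id C (fst (f i))" if "i \<in> A" for i
      using A that unfolding P_def by auto
    have h: "snd (f j) i \<in> hom C (fst (f i)) (fst (f j))" if "i \<in> A" "j \<in> A" "(i, j) \<in> \<nu>" for i j
    proof (cases "i = j")
      case True
      then show ?thesis using ob[OF that(1)] id_hom by simp
    next
      case False
      then have "i \<in> underS \<nu> j" using that unfolding underS_def by auto
      then show ?thesis using A that(2) unfolding P_def by auto
    qed
    have "snd (f k) j \<cdot> snd (f j) i = snd (f k) i"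
      if ijk: "i \<in> A" "j \<in> A" "k \<in> A" "(i, j) \<in> \<nu>" "(j, k) \<in> \<nu>" for i j k
    proof -
      have "i = k \<Longrightarrow> i = j" using ijk(4,5) wo(3)[of i j] by auto
      then consider "i = j" | "j = k" | "i \<in> underS \<nu> k" "j \<in> underS \<nu> k"
        using ijk(5) wo(2)[OF ijk(4,5)] unfolding underS_def by auto
      then show ?thesis
      proof cases
        case 1
        then show ?thesis using comp_id[OF h[of j k]] ob ijk by auto
      next
        case 2
        then show ?thesis using id_comp[OF h[of i k]] ob ijk by auto
      next
        case 3
        then show ?thesis using A(2)[OF ijk(3)] A(1) ijk(3,4) unfolding P_def by auto
      qed
    qed
    then show ?thesis
      unfolding diagram_def using ob h by auto
  qed
  have ex: "\<exists>x. P f k x" if IH: "\<And>y. (y, k) \<in> \<nu> - Relation.Id \<Longrightarrow> P f y (f y)" for f k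
  proof (cases "k \<in> Field \<nu>")
    case k: True
    have IH': "P f y (f y)" if "y \<in> underS \<nu> k" for y
      using IH that lt by blast
    have sub: "underS \<nu> k \<subseteq> Field \<nu>"
      using underS_Field[of _ \<nu>] by auto
    have D: "diagram C (underS \<nu> k) \<nu> (\<lambda>i. fst (f i)) (\<lambda>i j. snd (f j) i)"
      using diagram[OF sub IH'] .
    \<comment> \<open>Hence the colimit clause of \<open>P\<close> is vacuous at a successor, and
      the successor clause is vacuous at a limit.\<close>
    have no_suc: "\<not> limit_element \<nu> k" if "j \<in> Field \<nu>" "k = wo_rel.suc \<nu> {j}" for j
    proof
      assume "limit_element \<nu> k"
      moreover have "j \<in> underS \<nu> k"
        using reg_card_suc[OF \<nu> that(1)] that(2) unfolding underS_def by auto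
      ultimately have "k \<in> underS \<nu> k" unfolding limit_element_def using that(2) by auto
      then show False unfolding underS_def by auto
    qed
    show ?thesis
    proof (rule reg_card_cases[OF \<nu> k])
      assume "underS \<nu> k = {}"
      then have "P f k (X0, \<lambda>i. Id C X0)"
        using X0 unfolding P_def limit_element_def by auto
      then show ?thesis by blast
    next
      fix j assume 2: "j \<in> Field \<nu>" "k = wo_rel.suc \<nu> {j}"
      have j: "j \<in> underS \<nu> k"
        using 2 reg_card_suc[OF \<nu> 2(1)] unfolding underS_def by auto
      have le_j: "(i, j) \<in> \<nu>" if i: "i \<in> underS \<nu> k" for i
      proof (rule ccontr)
        assume n: "(i, j) \<notin> \<nu>"
        have i': "i \<in> Field \<nu>" using i sub by auto
        then have "(j, i) \<in> \<nu>" "j \<noteq> i" using n reg_card_total[OF \<nu> 2(1)] wo(1) by auto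
        then have "(k, i) \<in> \<nu>" using reg_card_suc_least[OF \<nu>, of j i] 2 by auto
        then show False using i wo(3) unfolding underS_def by auto
      qed
      have zk: "z \<in> underS \<nu> k"
        using z(2)[OF 2(1)] z(2)[OF k] j wo(3)[of z j] unfolding underS_def by auto
      have "fst (f z) = X0"
        using IH'[OF zk] z(1,3) unfolding P_def by simp
      moreover have "snd (f j) z \<in> hom C (fst (f z)) (fst (f j))"
        using D zk j le_j[OF zk] unfolding diagram_def by blast
      ultimately have "snd (f j) z \<in> hom C X0 (fst (f j))" by simp
      then obtain Y s where s: "s \<in> hom C (fst (f j)) Y" "S (snd (f j) z) s"
        using step by blast
      \<comment> \<open>Every arrow from an earlier stage passes through the predecessor
        \<open>j\<close> and then \<open>s\<close>; the one from \<open>j\<close> is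
        \<open>s\<close> itself, because \<open>snd (f j) j\<close> is an identity.\<close>
      define x where "x = (Y, \<lambda>i. if i = k then Id C Y else s \<cdot> snd (f j) i)"
      have x: "fst x = Y" "snd x k = Id C Y" "\<And>i. i \<in> underS \<nu> k \<Longrightarrow> snd x i = s \<cdot> snd (f j) i"
        unfolding x_def underS_def by auto
      have hj: "snd (f j) i \<in> hom C (fst (f i)) (fst (f j))" if "i \<in> underS \<nu> k" for i
        using D that j le_j[OF that] unfolding diagram_def by blast
      have "P f k x"
        unfolding P_def
      proof (intro impI conjI ballI)
        show "fst x \<in> Obj C" using x(1) s(1) hom_Obj by blast
        show "snd x k = Id C (fst x)" using x by simp
        show "snd x i \<in> hom C (fst (f i)) (fst x)" if "i \<in> underS \<nu> k" for i
          unfolding x(1) x(3)[OF that] using comp_hom[OF s(1) hj[OF that]] .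
        show "snd x i' \<cdot> snd (f i') i = snd x i"
          if "i' \<in> underS \<nu> k" "i \<in> underS \<nu> k" "(i, i') \<in> \<nu>" for i i'
        proof -
          have "snd (f i') i \<in> hom C (fst (f i)) (fst (f i'))"
            "snd (f j) i' \<cdot> snd (f i') i = snd (f j) i"
            using D that j le_j[OF that(1)] unfolding diagram_def by blast+
          then show ?thesis
            using x(3) that comp_assoc[OF s(1) hj[OF that(1)]] by metis
        qed
        show "fst x = X0" if "underS \<nu> k = {}" using that j by auto
        show "S (snd (f i) z) (snd x i)" if "i \<in> underS \<nu> k" "wo_rel.suc \<nu> {i} = k" for i
        proof -
          have "i = j" using reg_card_suc_inj[OF \<nu> _ 2(1)] that 2(2) sub by blast
          moreover have "snd (f j) j = Id C (fst (f j))"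
            using D j unfolding diagram_def by blast
          ultimately show ?thesis using x(3)[OF that(1)] s comp_id by simp
        qed
        show "colimit E (underS \<nu> k) \<nu> (\<lambda>i. F (fst (f i))) (\<lambda>i j. G (snd (f j) i)) (F (fst x))
           (\<lambda>i. G (snd x i))" if "limit_element \<nu> k"
          using no_suc[OF 2] that by blast
      qed
      then show ?thesis by blast
    next
      assume 3: "limit_element \<nu> k"
      then have ne: "underS \<nu> k \<noteq> {}" unfolding limit_element_def by auto
      obtain L l where L: "cocone C (underS \<nu> k) \<nu> (\<lambda>i. fst (f i)) (\<lambda>i j. snd (f j) i) L l"
        "colimit E (underS \<nu> k) \<nu> (\<lambda>i. F (fst (f i))) (\<lambda>i j. G (snd (f j) i)) (F L) (\<lambda>i. G (l i))"
        using colim[OF reg_card_Restr_directed[OF \<nu> sub ne]] D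
        unfolding diagram_Restr cocone_Restr colimit_Restr by blast
      define x where "x = (L, \<lambda>i. if i = k then Id C L else l i)"
      have x: "fst x = L" "snd x k = Id C L" "\<And>i. i \<in> underS \<nu> k \<Longrightarrow> snd x i = l i"
        unfolding x_def underS_def by auto
      have "P f k x"
        unfolding P_def
      proof (intro impI conjI ballI)
        show "snd x i \<in> hom C (fst (f i)) (fst x)" if "i \<in> underS \<nu> k" for i
          using L(1) x(1) x(3)[OF that] that unfolding cocone_def by auto
        show "fst x \<in> Obj C"
          using L(1) x(1) unfolding cocone_def by auto
        show "snd x i' \<cdot> snd (f i') i = snd x i"
          if "i' \<in> underS \<nu> k" "i \<in> underS \<nu> k" "(i, i') \<in> \<nu>" for i i'
          using L(1) x(3)[OF that(1)] x(3)[OF that(2)] that unfolding cocone_def by auto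
        show "S (snd (f i) z) (snd x i)" if "i \<in> underS \<nu> k" "wo_rel.suc \<nu> {i} = k" for i
          using no_suc[of i] that sub 3 by blast
        show "colimit E (underS \<nu> k) \<nu> (\<lambda>i. F (fst (f i))) (\<lambda>i j. G (snd (f j) i)) (F (fst x))
           (\<lambda>i. G (snd x i))"
          using L(2) x(1,3) colimit_cong[of "underS \<nu> k" _ _ \<nu> _ _ "\<lambda>i. G (l i)" "\<lambda>i. G (snd x i)" E]
          by auto
      qed (use x ne in auto)
      then show ?thesis by blast
    qed
  qed (simp add: P_def)
  \<comment> \<open>\<open>dependent_wf_choice\<close> requires that admissibility of a stage depend
    only on the stages strictly below it.\<close>
  have adm: "P f k x = P g k x" if "\<And>y. (y, k) \<in> \<nu> - Relation.Id \<Longrightarrow> f y = g y" for f g k x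
  proof -
    have fg: "f y = g y" if "y \<in> underS \<nu> k" for y
      using that \<open>\<And>y. (y, k) \<in> \<nu> - Relation.Id \<Longrightarrow> f y = g y\<close> lt by blast
    have "colimit E (underS \<nu> k) \<nu> (\<lambda>i. F (fst (f i))) (\<lambda>i j. G (snd (f j) i)) (F (fst x)) (\<lambda>i. G (snd x i))
      = colimit E (underS \<nu> k) \<nu> (\<lambda>i. F (fst (g i))) (\<lambda>i j. G (snd (g j) i)) (F (fst x)) (\<lambda>i. G (snd x i))"
      by (rule colimit_cong) (simp_all add: fg)
    then show ?thesis
      unfolding P_def by (simp add: fg)
  qed
  have "wf (\<nu> - Relation.Id)" using wo_rel.WF[OF reg_card_wo[OF \<nu>]] .
  then obtain f where f: "\<And>k. P f k (f k)"
    using dependent_wf_choice[of "\<nu> - Relation.Id" P] adm ex by blast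
  let ?X = "\<lambda>i. fst (f i)" and ?\<delta> = "\<lambda>i j. snd (f j) i"
  show ?thesis
  proof (intro exI[of _ ?X] exI[of _ ?\<delta>] conjI ballI allI impI)
    show "diagram C (Field \<nu>) \<nu> ?X ?\<delta>" using diagram[OF order_refl f] .
    show "?X z = X0" using f[of z] z(1,3) unfolding P_def by simp
    show "S (?\<delta> z i) (?\<delta> i (wo_rel.suc \<nu> {i}))" if "i \<in> Field \<nu>" for i
    proof -
      have "i \<in> underS \<nu> (wo_rel.suc \<nu> {i})"
        using reg_card_suc[OF \<nu> that] unfolding underS_def by auto
      then show ?thesis
        using f[of "wo_rel.suc \<nu> {i}"] reg_card_suc(3)[OF \<nu> that] unfolding P_def by simp
    qed
    show "colimit E (underS \<nu> k) \<nu> (\<lambda>i. F (?X i)) (\<lambda>i j. G (?\<delta> i j)) (F (?X k)) (\<lambda>i. G (?\<delta> i k))"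
      if "limit_element \<nu> k" for k
      using f[of k] that unfolding P_def limit_element_def by simp
  qed
qed

section \<open>Independence from consistency along a chain\<close>

lemma full_sub_simps [simp]:
  "Comp (full_sub C S) = Comp C" "Id (full_sub C S) = Id C"
  "Dom (full_sub C S) = Dom C" "Cod (full_sub C S) = Cod C" "Obj (full_sub C S) = S"
  by (simp_all add: full_sub_def)

lemma hom_full_sub [simp]: "f \<in> hom (full_sub C S) X Y \<longleftrightarrow> f \<in> hom C X Y \<and> X \<in> S \<and> Y \<in> S"
  by (auto simp: full_sub_def hom_def)

lemma into_full_sub [simp]: "into (full_sub C S) M m \<longleftrightarrow> into C M m \<and> Dom C m \<in> S \<and> M \<in> S"
  by (auto simp: full_sub_def into_def)

lemma mono_arr_full_sub:
  assumes "mono_arr C f" "f \<in> Arr (full_sub C S)"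
  shows "mono_arr (full_sub C S) f"
  using assms unfolding mono_arr_def by (auto simp: full_sub_simps(3))

lemma into_hom: "into C M a \<longleftrightarrow> a \<in> hom C (Dom C a) M"
  by (auto simp: into_def hom_def)

lemma hom_into: "a \<in> hom C X M \<Longrightarrow> into C M a"
  by (auto simp: into_def hom_def)

lemma hom_Dom: "a \<in> hom C X M \<Longrightarrow> Dom C a = X"
  by (auto simp: hom_def)

lemma diagram_full_sub:
  "S \<subseteq> Obj C \<Longrightarrow> diagram (full_sub C S) I r D \<delta> \<Longrightarrow> diagram C I r D \<delta>"
  unfolding diagram_def by auto

lemma cocone_full_sub:
  "S \<subseteq> Obj C \<Longrightarrow> cocone (full_sub C S) I r D \<delta> L l \<Longrightarrow> cocone C I r D \<delta> L l"
  unfolding cocone_def by auto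

lemma gtp_eq_sym: "gtp_eq C Mod as M as' M' \<Longrightarrow> gtp_eq C Mod as' M' as M"
  unfolding gtp_eq_def by metis

section \<open>Galois types under amalgamation\<close>

locale aecat_ap =
  fixes U :: "'u itself" and C :: "('o, 'a) category" (structure) and Mod :: "'o set"
  assumes aecat: "AECat U C Mod" and ap: "amalgamation C Mod"
begin

sublocale cat C
  using aecat unfolding AECat_def accessible_def cat_def by auto

sublocale sub: cat "full_sub C Mod"
  using aecat unfolding AECat_def accessible_def cat_def by auto

lemma Mod_Obj: "Mod \<subseteq> Obj C"
  using aecat unfolding AECat_def by auto

lemma all_mono: "f \<in> Arr C \<Longrightarrow> mono_arr C f"
  using aecat unfolding AECat_def by auto

lemma all_mono_sub: "f \<in> Arr (full_sub C Mod) \<Longrightarrow> mono_arr (full_sub C Mod) f"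
  by (rule mono_arr_full_sub[OF all_mono]) (auto simp: full_sub_def)

lemma directed_colimit_exists:
  assumes "directed_poset (I :: 'u set) r" "diagram (full_sub C Mod) I r D \<delta>"
  shows "\<exists>L l. colimit (full_sub C Mod) I r D \<delta> L l"
  using aecat assms unfolding AECat_def by simp

lemma directed_colimit_preserved:
  assumes "directed_poset (I :: 'u set) r" "diagram (full_sub C Mod) I r D \<delta>"
    "colimit (full_sub C Mod) I r D \<delta> L l"
  shows "colimit C I r D \<delta> L l"
  using aecat assms unfolding AECat_def by simp

lemma factorsI: "g \<in> hom C Y Z \<Longrightarrow> f \<in> hom C X Y \<Longrightarrow> factors C (g \<cdot> f) g"
  using comp_hom[of g Y Z f X] unfolding factors_def by (metis hom_Dom)

text \<open>\<open>N'\<close> itself serves as the common extension, reached by \<open>g\<close> and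
  by the identity.\<close>

lemma gtp_eq_push:
  assumes "g \<in> hom C N N'" "N \<in> Mod" "N' \<in> Mod" "\<forall>a\<in>set as. into C N a"
  shows "gtp_eq C Mod as N (map (\<lambda>a. g \<cdot> a) as) N'"
proof -
  have h: "g \<cdot> a \<in> hom C (Dom C a) N'" if "a \<in> set as" for a
    using comp_hom[OF assms(1)] assms(4) that unfolding into_hom by blast
  have "extension C Mod N N' g" "extension C Mod N' N' (Id C N')"
    using assms id_hom Mod_Obj unfolding extension_def by auto
  moreover have "map (\<lambda>a. g \<cdot> a) as = map (\<lambda>a. Id C N' \<cdot> a) (map (\<lambda>a. g \<cdot> a) as)"
    using id_comp[OF h] by simp
  moreover have "map (Dom C) as = map (Dom C) (map (\<lambda>a. g \<cdot> a) as)"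
    using hom_Dom[OF h] by simp
  moreover have "\<forall>a\<in>set (map (\<lambda>a. g \<cdot> a) as). into C N' a"
    using hom_into[OF h] by auto
  ultimately show ?thesis
    using assms(4) unfolding gtp_eq_def by blast
qed

text \<open>This is where amalgamation enters: both witnessing extensions receive \<open>M'\<close>,
  and they are amalgamated over it.\<close>

lemma gtp_eq_trans:
  assumes "gtp_eq C Mod as M as' M'" "gtp_eq C Mod as' M' as'' M''"
  shows "gtp_eq C Mod as M as'' M''"
proof -
  obtain N f f' where 1: "extension C Mod M N f" "extension C Mod M' N f'"
    "map (\<lambda>a. f \<cdot> a) as = map (\<lambda>a. f' \<cdot> a) as'"
    using assms(1) unfolding gtp_eq_def by blast
  obtain K g g' where 2: "extension C Mod M' K g" "extension C Mod M'' K g'"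
    "map (\<lambda>a. g \<cdot> a) as' = map (\<lambda>a. g' \<cdot> a) as''"
    using assms(2) unfolding gtp_eq_def by blast
  have into: "\<forall>a\<in>set as. into C M a" "\<forall>a\<in>set as'. into C M' a" "\<forall>a\<in>set as''. into C M'' a"
    using assms unfolding gtp_eq_def by auto
  have f: "f \<in> hom C M N" "f' \<in> hom C M' N" "g \<in> hom C M' K" "g' \<in> hom C M'' K"
    and Mods: "M \<in> Mod" "N \<in> Mod" "M' \<in> Mod" "M'' \<in> Mod" "K \<in> Mod"
    using 1 2 unfolding extension_def by auto
  obtain P h k where P: "P \<in> Mod" "h \<in> hom C N P" "k \<in> hom C K P" "h \<cdot> f' = k \<cdot> g"
    using ap Mods f unfolding amalgamation_def by meson
  have comp: "map (\<lambda>a. (v \<cdot> u) \<cdot> a) xs = map (\<lambda>a. v \<cdot> a) (map (\<lambda>a. u \<cdot> a) xs)"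
    if "v \<in> hom C Y Z" "u \<in> hom C X Y" "\<forall>a\<in>set xs. into C X a" for v u xs X Y Z
  proof -
    have "(v \<cdot> u) \<cdot> x = v \<cdot> u \<cdot> x" if "x \<in> set xs" for x
      using comp_assoc[OF \<open>v \<in> hom C Y Z\<close> \<open>u \<in> hom C X Y\<close>, of x "Dom C x"] that
        \<open>\<forall>a\<in>set xs. into C X a\<close> unfolding into_hom by simp
    then show ?thesis by simp
  qed
  have "map (\<lambda>a. (h \<cdot> f) \<cdot> a) as = map (\<lambda>a. (h \<cdot> f') \<cdot> a) as'"
    unfolding comp[OF P(2) f(1) into(1)] comp[OF P(2) f(2) into(2)] 1(3) ..
  also have "\<dots> = map (\<lambda>a. (k \<cdot> g') \<cdot> a) as''"
    unfolding P(4) comp[OF P(3) f(3) into(2)] comp[OF P(3) f(4) into(3)] 2(3) ..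
  finally have "map (\<lambda>a. (h \<cdot> f) \<cdot> a) as = map (\<lambda>a. (k \<cdot> g') \<cdot> a) as''" .
  moreover have "extension C Mod M P (h \<cdot> f)" "extension C Mod M'' P (k \<cdot> g')"
    using comp_hom P f Mods unfolding extension_def by auto
  moreover have "map (Dom C) as = map (Dom C) as''"
    using assms unfolding gtp_eq_def by auto
  ultimately show ?thesis
    using into(1,3) unfolding gtp_eq_def by blast
qed

end

section \<open>Rules for an independence relation and the transfer from consistency to
  independence\<close>

locale independence = aecat_ap U C Mod
  for U :: "'u itself" and C :: "('o, 'a) category" (structure) and Mod :: "'o set" +
  fixes base :: "'o set" and indep :: "('o, 'a) indep_rel"
  assumes basic: "basic_without_union C Mod base indep"
begin

lemma indepD:
  assumes "indep M a c b"
  shows "M \<in> Mod" "into C M a" "into C M c" "into C M b" "Dom C c \<in> base"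
proof -
  have "independence_relation C Mod base indep"
    using basic unfolding basic_without_union_def by (rule conjunct1)
  then have "\<forall>M a c b. indep M a c b \<longrightarrow>
        M \<in> Mod \<and> into C M a \<and> into C M c \<and> into C M b \<and> Dom C c \<in> base"
    unfolding independence_relation_def by (elim conjE)
  then show "M \<in> Mod" "into C M a" "into C M c" "into C M b" "Dom C c \<in> base"
    using assms by simp_all
qed

lemma invariance:
  "indep M a c b \<Longrightarrow> gtp_eq C Mod [a, b, c] M [a', b', c'] M' \<Longrightarrow> indep M' a' c' b'"
  using basic unfolding basic_without_union_def ind_invariance_def by metis

lemma symmetry: "indep M a c b \<Longrightarrow> indep M b c a"
  using basic unfolding basic_without_union_def ind_symmetry_def by metis

lemma monotonicity:
  "indep M a c b \<Longrightarrow> into C M a' \<Longrightarrow> factors C a' a \<Longrightarrow> indep M a' c b"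
  using basic unfolding basic_without_union_def ind_monotonicity_def by metis

lemma monotonicity_right:
  "indep M a c b \<Longrightarrow> into C M b' \<Longrightarrow> factors C b' b \<Longrightarrow> indep M a c b'"
  using symmetry monotonicity by metis

lemma transitivity:
  "indep M a b c \<Longrightarrow> indep M a c d \<Longrightarrow> factors C b c \<Longrightarrow> indep M a b d"
  using basic unfolding basic_without_union_def ind_transitivity_def by metis

lemma existence:
  "M \<in> Mod \<Longrightarrow> into C M a \<Longrightarrow> into C M c \<Longrightarrow> Dom C c \<in> base \<Longrightarrow> indep M a c c"
  using basic unfolding basic_without_union_def ind_existence_def by simp

lemma extension_axiom:
  assumes "indep M a c b" "into C M b'" "factors C b b'"
  shows "\<exists>N f a'. extension C Mod M N f \<and>
    gtp_eq C Mod [a', f \<cdot> b, f \<cdot> c] N [a, b, c] M \<and> indep N a' (f \<cdot> c) (f \<cdot> b')"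
  using basic assms unfolding basic_without_union_def ind_extension_def by simp

lemma indep_push:
  assumes "indep M a c b" "g \<in> hom C M N" "N \<in> Mod"
  shows "indep N (g \<cdot> a) (g \<cdot> c) (g \<cdot> b)"
  using invariance[OF assms(1)] gtp_eq_push[OF assms(2) _ assms(3), of "[a, b, c]"] indepD[OF assms(1)]
  by simp

text \<open>Both kinds of sequence are reduced to this. \<open>clubs\<close> is Club Local Character
  at the one cardinal \<kappa>, for every position of \<open>a'\<close> in every model, since
  \<open>a'\<close> is known only after consistency has been used. The first stage is
  \<open>M\<close>, so that \<open>m z\<close> is the extension in which the sequence lives and
  \<open>c\<close> lies below every stage.\<close>

lemma indep_from_consistency:
  fixes \<kappa> \<nu> :: "'u rel"
  defines "z \<equiv> wo_rel.minim \<nu> (Field \<nu>)"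
  assumes \<kappa>: "reg_card \<kappa>" and \<nu>: "reg_card \<nu>"
    and clubs: "\<And>N a' L w. N \<in> Mod \<Longrightarrow> a' \<in> hom C (Dom C a) N \<Longrightarrow> L \<in> Mod \<Longrightarrow> w \<in> hom C L N \<Longrightarrow>
      \<exists>F. club \<kappa> C Mod L F \<and> (\<forall>m0\<in>F. indep N a' (w \<cdot> m0) w)"
    and pres: "presentable \<kappa> (full_sub C Mod) M"
    and c: "into C M c"
    and X: "diagram (full_sub C Mod) (Field \<nu>) \<nu> X \<delta>" "X z = M"
    and m: "cocone (full_sub C Mod) (Field \<nu>) \<nu> X \<delta> N m"
    and bs: "\<And>i. i \<in> Field \<nu> \<Longrightarrow> factors C (bs i) (m (wo_rel.suc \<nu> {i}))"
      "\<And>i. i \<in> Field \<nu> \<Longrightarrow> indep N (bs i) (m z \<cdot> c) (m i)"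
    and I: "I \<subseteq> Field \<nu>" "|I| =o \<kappa>"
    and cons: "consistent_for C Mod a b c M N (m z) I bs"
  shows "indep M a c b"
proof -
  obtain e where e: "\<And>i. i \<in> Field \<kappa> \<Longrightarrow> e i \<in> I" "\<And>i j. (i, j) \<in> \<kappa> \<Longrightarrow> (e i, e j) \<in> \<nu>"
    "inj_on e (Field \<kappa>)"
    using reg_card_embed[OF \<kappa> \<nu> I] by metis
  have e\<nu>: "e i \<in> Field \<nu>" if "i \<in> Field \<kappa>" for i using e(1)[OF that] I(1) by auto
  have z: "z \<in> Field \<nu>" "\<And>i. i \<in> Field \<nu> \<Longrightarrow> (z, i) \<in> \<nu>"
    using reg_card_minim[OF \<nu>] reg_card_Field_nonempty[OF \<nu>] reg_card_Field[OF \<nu>]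
    unfolding z_def by blast+
  have N: "N \<in> Mod" using m unfolding cocone_def by simp
  have XM: "X i \<in> Mod" and m_hom: "m i \<in> hom C (X i) N" if "i \<in> Field \<nu>" for i
    using m that unfolding cocone_def by simp_all
  have \<delta>_hom: "\<delta> i j \<in> hom C (X i) (X j)" "m j \<cdot> \<delta> i j = m i" if "(i, j) \<in> \<nu>" for i j
    using X(1) m that reg_card_Field[OF \<nu> that] unfolding diagram_def cocone_def by simp_all
  define Y \<epsilon> where "Y = (\<lambda>i. X (e i))" and "\<epsilon> = (\<lambda>i j. \<delta> (e i) (e j))"
  have Y: "diagram (full_sub C Mod) (Field \<kappa>) \<kappa> Y \<epsilon>"
    unfolding diagram_def Y_def \<epsilon>_def
  proof (intro conjI ballI impI)
    fix i j k assume "i \<in> Field \<kappa>" "j \<in> Field \<kappa>" "k \<in> Field \<kappa>" "(i, j) \<in> \<kappa> \<and> (j, k) \<in> \<kappa>"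
    then show "\<delta> (e j) (e k) \<cdot>\<^bsub>full_sub C Mod\<^esub> \<delta> (e i) (e j) = \<delta> (e i) (e k)"
      using X(1) e\<nu> e(2) unfolding diagram_def by blast
  qed (use X(1) e\<nu> e(2) XM \<delta>_hom(1) in \<open>auto simp: diagram_def\<close>)
  have dir: "directed_poset (Field \<kappa>) (Restr \<kappa> (Field \<kappa>))"
    by (rule reg_card_Restr_directed[OF \<kappa> order_refl reg_card_Field_nonempty[OF \<kappa>]])
  then obtain L l where L: "colimit (full_sub C Mod) (Field \<kappa>) \<kappa> Y \<epsilon> L l"
    using directed_colimit_exists[OF dir] Y unfolding diagram_Restr colimit_Restr by blast
  then have lc: "cocone (full_sub C Mod) (Field \<kappa>) \<kappa> Y \<epsilon> L l"
    unfolding colimit_def by blast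
  then have LM: "L \<in> Mod" and l: "\<And>i. i \<in> Field \<kappa> \<Longrightarrow> l i \<in> hom C (X (e i)) L"
    unfolding cocone_def Y_def by simp_all
  have mc: "cocone (full_sub C Mod) (Field \<kappa>) \<kappa> Y \<epsilon> N (\<lambda>i. m (e i))"
    using N XM m_hom e\<nu> \<delta>_hom(2)[OF e(2)] unfolding cocone_def Y_def \<epsilon>_def by simp
  obtain u where "u \<in> hom (full_sub C Mod) L N"
    "\<forall>i\<in>Field \<kappa>. u \<cdot>\<^bsub>full_sub C Mod\<^esub> l i = m (e i)"
    by (rule sub.colimit_mediator[OF L mc])
  then have u: "u \<in> hom C L N" "\<forall>i\<in>Field \<kappa>. u \<cdot> l i = m (e i)" by simp_all
  obtain N' g a' where g: "extension C Mod N N' g" and a': "into C N' a'"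
    and gtp: "\<forall>i\<in>I. gtp_eq C Mod [a', g \<cdot> bs i, g \<cdot> (m z \<cdot> c)] N' [a, b, c] M"
    using cons unfolding consistent_for_def by blast
  have N': "N' \<in> Mod" and g_hom: "g \<in> hom C N N'" using g unfolding extension_def by auto
  define w where "w = g \<cdot> u"
  have w: "w \<in> hom C L N'" unfolding w_def using comp_hom[OF g_hom u(1)] .
  have wl: "w \<cdot> l i = g \<cdot> m (e i)" if "i \<in> Field \<kappa>" for i
    unfolding w_def using comp_assoc[OF g_hom u(1) l[OF that]] u(2) that by simp
  obtain i0 where i0: "i0 \<in> Field \<kappa>" using reg_card_Field_nonempty[OF \<kappa>] by blast
  have "Dom C a' = Dom C a" using gtp e(1)[OF i0] unfolding gtp_eq_def by auto
  then have "a' \<in> hom C (Dom C a) N'" using a' unfolding into_hom by simp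
  then obtain F where F: "club \<kappa> C Mod L F" "\<forall>m0\<in>F. indep N' a' (w \<cdot> m0) w"
    using clubs N' LM w by blast
  \<comment> \<open>\<open>M\<close> enters \<open>L\<close> through an arbitrary stage of the
    subchain. As \<open>M\<close> is \<kappa>-presentable, \<open>p\<close> is among the subobjects
    that the club dominates, so \<open>m0\<close> can be taken above \<open>M\<close> and hence
    above \<open>c\<close>: the inclusion that Transitivity requires.\<close>
  define p where "p = l i0 \<cdot> \<delta> z (e i0)"
  have zi0: "(z, e i0) \<in> \<nu>" using z(2) e\<nu> i0 by blast
  have \<delta>0: "\<delta> z (e i0) \<in> hom C M (X (e i0))" using \<delta>_hom(1)[OF zi0] X(2) by simp
  have p: "p \<in> hom C M L" unfolding p_def using comp_hom[OF l[OF i0] \<delta>0] .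
  have M: "M \<in> Mod" using XM[OF z(1)] X(2) by simp
  have "p \<in> Sub_Mod \<kappa> C Mod L"
    using p pres LM M hom_Dom[OF p] hom_into[OF p] unfolding Sub_Mod_def by simp
  then obtain m0 where m0: "m0 \<in> F" "factors C p m0"
    using F(1) unfolding club_def by blast
  then have "m0 \<in> Sub_Mod \<kappa> C Mod L" using F(1) unfolding club_def by blast
  then have m0_hom: "m0 \<in> hom C (Dom C m0) L" and m0M: "Dom C m0 \<in> Mod"
    and m0_pres: "presentable \<kappa> (full_sub C Mod) (Dom C m0)"
    unfolding Sub_Mod_def by (simp_all add: into_hom)
  have "m0 \<in> hom (full_sub C Mod) (Dom C m0) L" using m0_hom m0M LM by simp
  then obtain i q where i: "i \<in> Field \<kappa>" and "q \<in> hom (full_sub C Mod) (Dom C m0) (Y i)"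
    and "l i \<cdot>\<^bsub>full_sub C Mod\<^esub> q = m0"
    by (rule presentable_factor[OF m0_pres reg_card_card_directed[OF \<kappa>] Y L])
  then have q: "q \<in> hom C (Dom C m0) (X (e i))" "l i \<cdot> q = m0"
    unfolding Y_def by simp_all
  obtain t where t: "t \<in> hom C M (Dom C m0)" "m0 \<cdot> t = p"
    using m0(2) hom_Dom[OF p] unfolding factors_def by auto
  have wm0: "w \<cdot> m0 \<in> hom C (Dom C m0) N'" using comp_hom[OF w m0_hom] .
  have c_hom: "c \<in> hom C (Dom C c) M" using c unfolding into_hom .
  have mz: "m z \<in> hom C M N" using m_hom[OF z(1)] X(2) by simp
  let ?c = "g \<cdot> (m z \<cdot> c)" and ?b = "g \<cdot> bs (e i)"
  have ei: "e i \<in> Field \<nu>" using e\<nu> i .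
  have b_m: "indep N' ?b ?c (g \<cdot> m (e i))"
    using indep_push[OF bs(2)[OF ei] g_hom N'] .
  have "w \<cdot> m0 = (g \<cdot> m (e i)) \<cdot> q"
    using comp_assoc[OF w l[OF i] q(1)] q(2) wl[OF i] by simp
  then have "factors C (w \<cdot> m0) (g \<cdot> m (e i))"
    using factorsI[OF comp_hom[OF g_hom m_hom[OF ei]] q(1)] by simp
  then have b_m0: "indep N' ?b ?c (w \<cdot> m0)"
    using monotonicity_right[OF b_m hom_into[OF wm0]] by simp
  have c_m0: "factors C ?c (w \<cdot> m0)"
  proof -
    have "(w \<cdot> m0) \<cdot> t = w \<cdot> p"
      using comp_assoc[OF w m0_hom t(1)] t(2) by simp
    also have "\<dots> = (g \<cdot> m (e i0)) \<cdot> \<delta> z (e i0)"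
      unfolding p_def using comp_assoc[OF w l[OF i0] \<delta>0] wl[OF i0] by simp
    also have "\<dots> = g \<cdot> m z"
      using comp_assoc[OF g_hom m_hom[OF e\<nu>[OF i0]] \<delta>0] \<delta>_hom(2)[OF zi0] by simp
    finally have "?c = (w \<cdot> m0) \<cdot> (t \<cdot> c)"
      using comp_assoc[OF g_hom mz c_hom] comp_assoc[OF wm0 t(1) c_hom] by simp
    then show ?thesis using factorsI[OF wm0 comp_hom[OF t(1) c_hom]] by simp
  qed
  have b_w: "factors C ?b w"
  proof -
    \<comment> \<open>\<open>bs (e i)\<close> lies in the stage just after \<open>e i\<close>, which
      need not be among the chosen indices. But the chosen index \<open>e j\<close> is strictly
      above \<open>e i\<close>, hence at or above its successor, so \<open>bs (e i)\<close> lies in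
      \<open>L\<close>.\<close>
    define s where "s = wo_rel.suc \<nu> {e i}"
    define j where "j = wo_rel.suc \<kappa> {i}"
    have j: "j \<in> Field \<kappa>" "(i, j) \<in> \<kappa>" "i \<noteq> j"
      unfolding j_def using reg_card_suc[OF \<kappa> i] by auto
    then have "e i \<noteq> e j" using e(3) i unfolding inj_on_def by blast
    then have sj: "(s, e j) \<in> \<nu>"
      unfolding s_def using reg_card_suc_least[OF \<nu> e(2)[OF j(2)]] by simp
    have s: "s \<in> Field \<nu>" using reg_card_Field[OF \<nu> sj] by simp
    obtain v where v: "v \<in> hom C (Dom C (bs (e i))) (X s)" "m s \<cdot> v = bs (e i)"
      using bs(1)[OF ei] hom_Dom[OF m_hom[OF s]] unfolding factors_def s_def by auto
    have \<delta>v: "\<delta> s (e j) \<cdot> v \<in> hom C (Dom C (bs (e i))) (X (e j))"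
      using comp_hom[OF \<delta>_hom(1)[OF sj] v(1)] .
    have "bs (e i) = m (e j) \<cdot> \<delta> s (e j) \<cdot> v"
      using comp_assoc[OF m_hom[OF e\<nu>[OF j(1)]] \<delta>_hom(1)[OF sj] v(1)] \<delta>_hom(2)[OF sj] v(2) by simp
    then have "?b = w \<cdot> l j \<cdot> \<delta> s (e j) \<cdot> v"
      using comp_assoc[OF g_hom m_hom[OF e\<nu>[OF j(1)]] \<delta>v] comp_assoc[OF w l[OF j(1)] \<delta>v] wl[OF j(1)]
      by simp
    then show ?thesis using factorsI[OF w comp_hom[OF l[OF j(1)] \<delta>v]] by simp
  qed
  \<comment> \<open>Monotonicity acts on the left argument, so the relation given by the club is
    reversed before \<open>w\<close> is shrunk to \<open>?b\<close>; Transitivity then lowers the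
    base from \<open>w \<cdot> m0\<close> to \<open>?c\<close>.\<close>
  have "indep N' w (w \<cdot> m0) a'"
    using symmetry F(2) m0(1) by blast
  then have "indep N' ?b (w \<cdot> m0) a'"
    using monotonicity[OF _ _ b_w] indepD(2)[OF b_m] by blast
  then have "indep N' ?b ?c a'"
    using transitivity[OF b_m0 _ c_m0] by blast
  then show ?thesis
    using invariance[OF symmetry] gtp e(1)[OF i] by blast
qed

text \<open>The cardinals are chosen in the order \<kappa>, from \<open>a\<close> and
  \<open>M\<close>, then a threshold \<mu> above \<kappa>, and only then the length \<nu> at which
  dividing fails. As \<nu> is not under control, \<open>seqs\<close> has to supply sequences of
  every regular length. \<open>P\<close> is left open so that long dividing and isi-dividing share
  the argument.\<close>

lemma indep_if_not_divides:
  fixes P :: "'u rel \<Rightarrow> ('u \<Rightarrow> 'a) \<Rightarrow> 'o \<Rightarrow> 'a \<Rightarrow> bool"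
  assumes univ: "universe U" and clc: "club_local_character U C Mod indep"
    and M: "M \<in> Mod" and a: "into C M a" and c: "into C M c"
    and nd: "\<not> divides_along P C Mod a b c M"
    and seqs: "\<And>\<nu> :: 'u rel. reg_card \<nu> \<Longrightarrow> \<exists>N bs X \<delta> m.
      X (wo_rel.minim \<nu> (Field \<nu>)) = M \<and>
      diagram (full_sub C Mod) (Field \<nu>) \<nu> X \<delta> \<and> cocone (full_sub C Mod) (Field \<nu>) \<nu> X \<delta> N m \<and>
      P \<nu> bs N (m (wo_rel.minim \<nu> (Field \<nu>)) \<cdot> c) \<and>
      (\<forall>i\<in>Field \<nu>. gtp_eq C Mod [bs i, m (wo_rel.minim \<nu> (Field \<nu>)) \<cdot> c] N [b, c] M \<and>
        factors C (bs i) (m (wo_rel.suc \<nu> {i})) \<and>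
        indep N (bs i) (m (wo_rel.minim \<nu> (Field \<nu>)) \<cdot> c) (m i))"
  shows "indep M a c b"
proof -
  have "Dom C a \<in> Obj C" using hom_Obj a unfolding into_hom by blast
  then obtain \<theta> :: "'u rel" where \<theta>: "reg_card \<theta>" "presentable \<theta> C (Dom C a)"
    using accessible_presentable[OF univ _ all_mono] aecat unfolding AECat_def by blast
  \<comment> \<open>Presentability of \<open>M\<close> is measured among the models, as in
    \<open>Sub_Mod\<close>, whereas that of the domain of \<open>a\<close> is measured in
    \<open>C\<close>, as in Club Local Character.\<close>
  obtain \<kappa>M :: "'u rel" where \<kappa>M: "reg_card \<kappa>M" "presentable \<kappa>M (full_sub C Mod) M"
    using accessible_presentable[OF univ _ all_mono_sub] aecat M unfolding AECat_def
    by (metis full_sub_simps(5))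
  obtain \<Upsilon> :: "'u rel" where \<Upsilon>: "reg_card \<Upsilon>"
    "\<forall>\<kappa> :: 'u rel. reg_card \<kappa> \<and> \<Upsilon> \<le>o \<kappa> \<longrightarrow>
      (\<forall>N M a m. N \<in> Mod \<and> into C N a \<and> presentable \<theta> C (Dom C a) \<and> M \<in> Mod \<and> m \<in> hom C M N \<longrightarrow>
        (\<exists>F. club \<kappa> C Mod M F \<and> (\<forall>m0 \<in> F. indep N a (m \<cdot> m0) m)))"
    using clc[unfolded club_local_character_def, THEN spec[of _ \<theta>], THEN mp, OF \<theta>(1)]
    by (elim exE conjE, intro that) assumption+
  obtain \<kappa> :: "'u rel" where \<kappa>: "reg_card \<kappa>" "\<Upsilon> \<le>o \<kappa>" "\<kappa>M \<le>o \<kappa>"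
    by (rule reg_card_common_bound[OF \<Upsilon>(1) \<kappa>M(1)])
  \<comment> \<open>The threshold exceeds \<kappa>, so that \<kappa> is an admissible size of
    subfamilies at every length from \<mu> on.\<close>
  obtain \<mu> :: "'u rel" where \<mu>: "reg_card \<mu>" "|Field \<kappa>| <o \<mu>"
    using reg_card_above[OF univ, of "Field \<kappa>"] reg_card_small[OF \<kappa>(1)] unfolding small_def by blast
  \<comment> \<open>Failure of dividing at the threshold \<mu>: at one length \<nu>, every
    admissible sequence has consistent subfamilies of each smaller regular size.\<close>
  obtain \<nu> :: "'u rel" where \<nu>: "reg_card \<nu>" "\<mu> \<le>o \<nu>"
    "\<And>N f bs. extension C Mod M N f \<Longrightarrow> (\<forall>i\<in>Field \<nu>. gtp_eq C Mod [bs i, f \<cdot> c] N [b, c] M) \<Longrightarrow>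
      P \<nu> bs N (f \<cdot> c) \<Longrightarrow>
      \<forall>\<kappa> :: 'u rel. reg_card \<kappa> \<and> \<kappa> <o \<nu> \<longrightarrow>
        (\<exists>I. I \<subseteq> Field \<nu> \<and> |I| =o \<kappa> \<and> consistent_for C Mod a b c M N f I bs)"
    using nd \<mu>(1) unfolding divides_along_def by (metis (no_types, lifting))
  have "\<kappa> =o |Field \<kappa>|"
    using card_of_Field_ordIso ordIso_symmetric \<kappa>(1) unfolding reg_card_def by blast
  then have \<kappa>\<nu>: "\<kappa> <o \<nu>"
    using ordIso_ordLess_trans[OF _ ordLess_ordLeq_trans[OF \<mu>(2) \<nu>(2)]] by blast
  let ?z = "wo_rel.minim \<nu> (Field \<nu>)"
  obtain N bs X \<delta> m where X: "X ?z = M" "diagram (full_sub C Mod) (Field \<nu>) \<nu> X \<delta>"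
    "cocone (full_sub C Mod) (Field \<nu>) \<nu> X \<delta> N m" "P \<nu> bs N (m ?z \<cdot> c)"
    and bs: "\<forall>i\<in>Field \<nu>. gtp_eq C Mod [bs i, m ?z \<cdot> c] N [b, c] M \<and>
        factors C (bs i) (m (wo_rel.suc \<nu> {i})) \<and> indep N (bs i) (m ?z \<cdot> c) (m i)"
    using seqs[OF \<nu>(1)] by (elim exE conjE, intro that) auto
  have z: "?z \<in> Field \<nu>"
    using reg_card_minim[OF \<nu>(1)] reg_card_Field_nonempty[OF \<nu>(1)] reg_card_Field[OF \<nu>(1)] by blast
  have "extension C Mod M N (m ?z)"
    using X(1,3) z M unfolding extension_def cocone_def by auto
  then obtain I where I: "I \<subseteq> Field \<nu>" "|I| =o \<kappa>" "consistent_for C Mod a b c M N (m ?z) I bs"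
    using \<nu>(3)[of N "m ?z" bs] bs X(4) \<kappa>(1) \<kappa>\<nu> by blast
  have clubs: "\<exists>F. club \<kappa> C Mod L F \<and> (\<forall>m0\<in>F. indep N a' (w \<cdot> m0) w)"
    if "N \<in> Mod" "a' \<in> hom C (Dom C a) N" "L \<in> Mod" "w \<in> hom C L N" for N a' L w
    using \<Upsilon>(2) \<kappa>(1,2) \<theta>(2) that hom_into[OF that(2)] hom_Dom[OF that(2)] by simp
  show ?thesis
    by (rule indep_from_consistency[OF \<kappa>(1) \<nu>(1) clubs presentable_mono[OF \<kappa>M(2) \<kappa>(3)] c X(2,1,3) _ _ I])
      (use bs in auto)
qed

end

section \<open>Independent sequences\<close>

text \<open>
  An isi-sequence is read off a continuous chain in the category of the following data, where
  \<open>elt\<close> is independent of \<open>lower\<close> over \<open>par\<close> in \<open>upper\<close>. A successor step takes the old \<open>upper\<close> as the new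
  \<open>lower\<close> and extends the type of \<open>elt\<close> to it; since \<open>elt\<close> is preserved by the arrows, all elements of
  the sequence have the same type over the earlier stages.
\<close>

record ('o, 'a) realization =
  lower :: 'o
  upper :: 'o
  emb :: 'a
  elt :: 'a
  par :: 'a

type_synonym ('o, 'a) realization_arrow =
  "('o, 'a) realization \<times> ('o, 'a) realization \<times> 'a \<times> 'a"

abbreviation low :: "('o, 'a) realization_arrow \<Rightarrow> 'a" where
  "low f \<equiv> fst (snd (snd f))"

abbreviation upp :: "('o, 'a) realization_arrow \<Rightarrow> 'a" where
  "upp f \<equiv> snd (snd (snd f))"

context aecat_ap
begin

lemma chain_cocone:
  fixes \<nu> :: "'u rel"
  assumes \<nu>: "reg_card \<nu>" and X: "diagram (full_sub C Mod) (Field \<nu>) \<nu> X \<delta>"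
  shows "\<exists>N m. cocone (full_sub C Mod) (Field \<nu>) \<nu> X \<delta> N m"
proof -
  have "directed_poset (Field \<nu>) (Restr \<nu> (Field \<nu>))"
    by (rule reg_card_Restr_directed[OF \<nu> order_refl reg_card_Field_nonempty[OF \<nu>]])
  then obtain N m where "colimit (full_sub C Mod) (Field \<nu>) (Restr \<nu> (Field \<nu>)) X \<delta> N m"
    using directed_colimit_exists X diagram_Restr by blast
  then have "cocone (full_sub C Mod) (Field \<nu>) \<nu> X \<delta> N m"
    unfolding colimit_Restr unfolding colimit_def by (rule conjunct1)
  then show ?thesis by (intro exI)
qed

end

context independence
begin

text \<open>Existence makes \<open>b\<close> independent of \<open>c\<close> over \<open>c\<close>,
  and Extension enlarges the right-hand \<open>c\<close> to all of \<open>X\<close>, represented by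
  its identity. In the type, \<open>c\<close> occurs twice, as base and as right-hand side.\<close>

lemma independent_realization:
  assumes "X \<in> Mod" "into C X b" "into C X c" "Dom C c \<in> base"
  shows "\<exists>N f b'. extension C Mod X N f \<and> into C N b' \<and>
    gtp_eq C Mod [b', f \<cdot> c] N [b, c] X \<and> indep N b' (f \<cdot> c) f"
proof -
  have X: "Id C X \<in> hom C X X" using assms(1) Mod_Obj id_hom by blast
  have c: "c \<in> hom C (Dom C c) X" using assms(3) unfolding into_hom .
  have "factors C c (Id C X)"
    using factorsI[OF X c] id_comp[OF c] by simp
  then obtain N f b' where f: "extension C Mod X N f"
    and gtp: "gtp_eq C Mod [b', f \<cdot> c, f \<cdot> c] N [b, c, c] X"
    and ind: "indep N b' (f \<cdot> c) (f \<cdot> Id C X)"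
    using extension_axiom[OF existence[OF assms] hom_into[OF X]] by blast
  have "f \<cdot> Id C X = f" using comp_id f unfolding extension_def by blast
  moreover have "gtp_eq C Mod [b', f \<cdot> c] N [b, c] X"
    using gtp unfolding gtp_eq_def by simp
  ultimately show ?thesis using f ind indepD(2)[OF ind] by auto
qed

text \<open>A realisation found at the successor stage is known only inside \<open>X s\<close>. The
  arrow \<open>m s\<close> moves its type and its independence into \<open>N\<close>, and turns the
  copy of \<open>c\<close> in \<open>X s\<close> into \<open>m z \<cdot> c\<close>, which is the
  same for all \<open>i\<close>.\<close>

lemma push_along_cocone:
  fixes \<nu> :: "'u rel"
  defines "z \<equiv> wo_rel.minim \<nu> (Field \<nu>)"
  assumes \<nu>: "reg_card \<nu>" and X: "diagram (full_sub C Mod) (Field \<nu>) \<nu> X \<delta>" "X z = M"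
    and m: "cocone (full_sub C Mod) (Field \<nu>) \<nu> X \<delta> N m"
    and c: "into C M c" and i: "i \<in> Field \<nu>"
  defines "s \<equiv> wo_rel.suc \<nu> {i}"
  assumes b': "gtp_eq C Mod [b', \<delta> i s \<cdot> \<delta> z i \<cdot> c] (X s) [b, c] M"
    and ind: "indep (X s) b' (\<delta> i s \<cdot> \<delta> z i \<cdot> c) (\<delta> i s)"
  shows "gtp_eq C Mod [m s \<cdot> b', m z \<cdot> c] N [b, c] M \<and> factors C (m s \<cdot> b') (m s) \<and>
    indep N (m s \<cdot> b') (m z \<cdot> c) (m i)"
proof -
  have s: "(i, s) \<in> \<nu>" "s \<in> Field \<nu>" unfolding s_def using reg_card_suc[OF \<nu> i] by auto
  have z: "(z, i) \<in> \<nu>" "z \<in> Field \<nu>"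
    using reg_card_minim[OF \<nu> i] reg_card_Field[OF \<nu>] unfolding z_def by auto
  have N: "N \<in> Mod" using m unfolding cocone_def by simp
  have XM: "X i \<in> Mod" and m_hom: "m i \<in> hom C (X i) N" if "i \<in> Field \<nu>" for i
    using m that unfolding cocone_def by simp_all
  have \<delta>: "\<delta> i j \<in> hom C (X i) (X j)" "m j \<cdot> \<delta> i j = m i" if "(i, j) \<in> \<nu>" for i j
    using X(1) m that reg_card_Field[OF \<nu> that] unfolding diagram_def cocone_def by simp_all
  have c': "c \<in> hom C (Dom C c) (X z)" using c X(2) unfolding into_hom by simp
  have "m s \<cdot> \<delta> i s \<cdot> \<delta> z i \<cdot> c = m i \<cdot> \<delta> z i \<cdot> c"
    using comp_assoc[OF m_hom[OF s(2)] \<delta>(1)[OF s(1)] comp_hom[OF \<delta>(1)[OF z(1)] c']] \<delta>(2)[OF s(1)]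
    by simp
  also have "\<dots> = m z \<cdot> c"
    using comp_assoc[OF m_hom[OF i] \<delta>(1)[OF z(1)] c'] \<delta>(2)[OF z(1)] by simp
  finally have mc: "m s \<cdot> \<delta> i s \<cdot> \<delta> z i \<cdot> c = m z \<cdot> c" .
  have into: "into C (X s) b'" "into C (X s) (\<delta> i s \<cdot> \<delta> z i \<cdot> c)"
    using indepD[OF ind] by auto
  have "gtp_eq C Mod [b', \<delta> i s \<cdot> \<delta> z i \<cdot> c] (X s) [m s \<cdot> b', m z \<cdot> c] N"
    using gtp_eq_push[OF m_hom[OF s(2)] XM[OF s(2)] N, of "[b', \<delta> i s \<cdot> \<delta> z i \<cdot> c]"] into mc by simp
  then have "gtp_eq C Mod [m s \<cdot> b', m z \<cdot> c] N [b, c] M"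
    using gtp_eq_trans[OF gtp_eq_sym b'] by blast
  moreover have "factors C (m s \<cdot> b') (m s)"
    using factorsI[OF m_hom[OF s(2)]] into(1) unfolding into_hom by blast
  moreover have "indep N (m s \<cdot> b') (m z \<cdot> c) (m i)"
    using indep_push[OF ind m_hom[OF s(2)] N] mc \<delta>(2)[OF s(1)] by simp
  ultimately show ?thesis by blast
qed

text \<open>Each successor stage brings a fresh realisation, linked to the earlier ones only by its
  type over \<open>c\<close>. Limit stages carry no realisation, so the chain can be built among the
  models alone.\<close>

lemma independent_sequence:
  fixes \<nu> :: "'u rel"
  defines "z \<equiv> wo_rel.minim \<nu> (Field \<nu>)"
  assumes \<nu>: "reg_card \<nu>" and M: "M \<in> Mod" and b: "into C M b" and c: "into C M c" "Dom C c \<in> base"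
  shows "\<exists>N bs X \<delta> m. X z = M \<and>
    diagram (full_sub C Mod) (Field \<nu>) \<nu> X \<delta> \<and> cocone (full_sub C Mod) (Field \<nu>) \<nu> X \<delta> N m \<and>
    (\<forall>i\<in>Field \<nu>. gtp_eq C Mod [bs i, m z \<cdot> c] N [b, c] M \<and>
      factors C (bs i) (m (wo_rel.suc \<nu> {i})) \<and> indep N (bs i) (m z \<cdot> c) (m i))"
proof -
  \<comment> \<open>\<open>g\<close>, the arrow from \<open>M\<close> to the current stage, is what
    brings \<open>c\<close> there; since \<open>S\<close> sees arrows only, the new stage is read
    off as \<open>Cod C s\<close>.\<close>
  define S where "S g s \<longleftrightarrow> (\<exists>b'. gtp_eq C Mod [b', s \<cdot> g \<cdot> c] (Cod C s) [b, c] M \<and>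
    indep (Cod C s) b' (s \<cdot> g \<cdot> c) s)" for g s
  have step: "\<exists>Y s. s \<in> hom (full_sub C Mod) X Y \<and> S g s"
    if "g \<in> hom (full_sub C Mod) M X" for X g
  proof -
    have g: "g \<in> hom C M X" "X \<in> Mod" using that by simp_all
    have gb: "g \<cdot> b \<in> hom C (Dom C b) X" and gc: "g \<cdot> c \<in> hom C (Dom C c) X"
      using comp_hom[OF g(1)] b c(1) unfolding into_hom by blast+
    have "Dom C (g \<cdot> c) \<in> base" using hom_Dom[OF gc] c(2) by simp
    then obtain N f b' where f: "extension C Mod X N f"
      and gtp: "gtp_eq C Mod [b', f \<cdot> g \<cdot> c] N [g \<cdot> b, g \<cdot> c] X" and ind: "indep N b' (f \<cdot> g \<cdot> c) f"
      using independent_realization[OF g(2) hom_into[OF gb] hom_into[OF gc]] by blast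
    have "gtp_eq C Mod [b, c] M [g \<cdot> b, g \<cdot> c] X"
      using gtp_eq_push[OF g(1) M g(2), of "[b, c]"] b c(1) by simp
    then have "gtp_eq C Mod [g \<cdot> b, g \<cdot> c] X [b, c] M"
      by (rule gtp_eq_sym)
    then have "gtp_eq C Mod [b', f \<cdot> g \<cdot> c] N [b, c] M"
      by (rule gtp_eq_trans[OF gtp])
    moreover have fh: "f \<in> hom C X N" "N \<in> Mod" using f unfolding extension_def by auto
    moreover have "Cod C f = N" using fh(1) unfolding hom_def by simp
    ultimately have "f \<in> hom (full_sub C Mod) X N \<and> S g f"
      using ind g(2) unfolding S_def by auto
    then show ?thesis by blast
  qed
  have "\<exists>X \<delta>. diagram (full_sub C Mod) (Field \<nu>) \<nu> X \<delta> \<and> X z = M \<and>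
    (\<forall>i\<in>Field \<nu>. S (\<delta> z i) (\<delta> i (wo_rel.suc \<nu> {i}))) \<and>
    (\<forall>k. limit_element \<nu> k \<longrightarrow>
      colimit (full_sub C Mod) (underS \<nu> k) \<nu> (\<lambda>i. X i) (\<lambda>i j. \<delta> i j) (X k) (\<lambda>i. \<delta> i k))"
    unfolding z_def
  proof (rule sub.continuous_chain[where F = "\<lambda>x. x" and G = "\<lambda>x. x", OF \<nu> _ step])
    show "\<exists>L l. cocone (full_sub C Mod) I r X \<delta> L l \<and> colimit (full_sub C Mod) I r X \<delta> L l"
      if "directed_poset I r" "diagram (full_sub C Mod) I r X \<delta>" for I :: "'u set" and r X \<delta>
      using directed_colimit_exists[OF that] unfolding colimit_def by blast
  qed (simp_all add: M)
  then obtain X \<delta> where X: "diagram (full_sub C Mod) (Field \<nu>) \<nu> X \<delta>" "X z = M"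
    and S: "\<forall>i\<in>Field \<nu>. S (\<delta> z i) (\<delta> i (wo_rel.suc \<nu> {i}))"
    by blast
  obtain N m where m: "cocone (full_sub C Mod) (Field \<nu>) \<nu> X \<delta> N m"
    using chain_cocone[OF \<nu> X(1)] by blast
  obtain b' where b': "\<forall>i\<in>Field \<nu>. gtp_eq C Mod [b' i, \<delta> i (wo_rel.suc \<nu> {i}) \<cdot> \<delta> z i \<cdot> c]
        (Cod C (\<delta> i (wo_rel.suc \<nu> {i}))) [b, c] M \<and>
      indep (Cod C (\<delta> i (wo_rel.suc \<nu> {i}))) (b' i) (\<delta> i (wo_rel.suc \<nu> {i}) \<cdot> \<delta> z i \<cdot> c)
        (\<delta> i (wo_rel.suc \<nu> {i}))"
    using bchoice[OF S[unfolded S_def]] by blast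
  have cod: "Cod C (\<delta> i (wo_rel.suc \<nu> {i})) = X (wo_rel.suc \<nu> {i})" if "i \<in> Field \<nu>" for i
    using X(1) reg_card_suc[OF \<nu> that] that unfolding diagram_def by (simp add: hom_def)
  define bs where "bs i = m (wo_rel.suc \<nu> {i}) \<cdot> b' i" for i
  have "\<forall>i\<in>Field \<nu>. gtp_eq C Mod [bs i, m z \<cdot> c] N [b, c] M \<and>
      factors C (bs i) (m (wo_rel.suc \<nu> {i})) \<and> indep N (bs i) (m z \<cdot> c) (m i)"
  proof
    fix i assume i: "i \<in> Field \<nu>"
    note b'i = bspec[OF b' i, unfolded cod[OF i] z_def]
    show "gtp_eq C Mod [bs i, m z \<cdot> c] N [b, c] M \<and>
      factors C (bs i) (m (wo_rel.suc \<nu> {i})) \<and> indep N (bs i) (m z \<cdot> c) (m i)"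
      unfolding bs_def z_def
      by (rule push_along_cocone[OF \<nu> X(1) X(2)[unfolded z_def] m c(1) i
            conjunct1[OF b'i] conjunct2[OF b'i]])
  qed
  then show ?thesis using X m by blast
qed

section \<open>The category of independent realizations\<close>

definition realizations :: "('o, 'a) realization set" where
  "realizations = {x. lower x \<in> Mod \<and> upper x \<in> Mod \<and> emb x \<in> hom C (lower x) (upper x) \<and>
     into C (lower x) (par x) \<and> indep (upper x) (elt x) (emb x \<cdot> par x) (emb x)}"

text \<open>Source and target are stored because the two components do not determine them:
  realizations over the same models may differ in \<open>emb\<close>, \<open>elt\<close> or
  \<open>par\<close>.\<close>

definition realization_arrow :: "('o, 'a) realization_arrow \<Rightarrow> bool" where
  "realization_arrow f \<longleftrightarrow> (let x = fst f; y = fst (snd f) in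
     x \<in> realizations \<and> y \<in> realizations \<and>
     low f \<in> hom C (lower x) (lower y) \<and> upp f \<in> hom C (upper x) (upper y) \<and>
     upp f \<cdot> emb x = emb y \<cdot> low f \<and> upp f \<cdot> elt x = elt y \<and> low f \<cdot> par x = par y)"

definition realization_cat :: "(('o, 'a) realization, ('o, 'a) realization_arrow) category" where
  "realization_cat =
    \<lparr>Obj = realizations, Arr = Collect realization_arrow, Dom = fst, Cod = (\<lambda>f. fst (snd f)),
     Id = (\<lambda>x. (x, x, Id C (lower x), Id C (upper x))),
     Comp = (\<lambda>g f. (fst f, fst (snd g), low g \<cdot> low f, upp g \<cdot> upp f))\<rparr>"

lemma realization_cat_simps [simp]:
  "Obj realization_cat = realizations"
  "Id realization_cat x = (x, x, Id C (lower x), Id C (upper x))"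
  "Comp realization_cat g f = (fst f, fst (snd g), low g \<cdot> low f, upp g \<cdot> upp f)"
  by (simp_all add: realization_cat_def)

lemma hom_realization_cat:
  "f \<in> hom realization_cat x y \<longleftrightarrow> fst f = x \<and> fst (snd f) = y \<and>
     x \<in> realizations \<and> y \<in> realizations \<and>
     low f \<in> hom C (lower x) (lower y) \<and> upp f \<in> hom C (upper x) (upper y) \<and>
     upp f \<cdot> emb x = emb y \<cdot> low f \<and> upp f \<cdot> elt x = elt y \<and> low f \<cdot> par x = par y"
  by (auto simp: hom_def realization_cat_def realization_arrow_def Let_def)

lemma realizationsD:
  assumes "x \<in> realizations"
  shows "lower x \<in> Mod" "upper x \<in> Mod" "emb x \<in> hom C (lower x) (upper x)"
    "par x \<in> hom C (Dom C (par x)) (lower x)" "elt x \<in> hom C (Dom C (elt x)) (upper x)"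
    "indep (upper x) (elt x) (emb x \<cdot> par x) (emb x)"
  using assms indepD(2) unfolding realizations_def into_hom by auto

lemma realization_cat_comp:
  assumes "f \<in> hom realization_cat x y" "g \<in> hom realization_cat y z"
  shows "g \<cdot>\<^bsub>realization_cat\<^esub> f \<in> hom realization_cat x z"
proof -
  note f = assms(1)[unfolded hom_realization_cat] and g = assms(2)[unfolded hom_realization_cat]
  have R: "x \<in> realizations" "y \<in> realizations" "z \<in> realizations"
    and lf: "low f \<in> hom C (lower x) (lower y)" and uf: "upp f \<in> hom C (upper x) (upper y)"
    and lg: "low g \<in> hom C (lower y) (lower z)" and ug: "upp g \<in> hom C (upper y) (upper z)"
    using f g by auto
  note x = realizationsD[OF R(1)] and y = realizationsD[OF R(2)] and z = realizationsD[OF R(3)]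
  have "(upp g \<cdot> upp f) \<cdot> emb x = upp g \<cdot> emb y \<cdot> low f"
    using comp_assoc[OF ug uf x(3)] f by simp
  also have "\<dots> = (emb z \<cdot> low g) \<cdot> low f"
    using comp_assoc[OF ug y(3) lf] g by simp
  also have "\<dots> = emb z \<cdot> low g \<cdot> low f"
    using comp_assoc[OF z(3) lg lf] by simp
  finally have "(upp g \<cdot> upp f) \<cdot> emb x = emb z \<cdot> low g \<cdot> low f" .
  moreover have "(upp g \<cdot> upp f) \<cdot> elt x = elt z"
    using comp_assoc[OF ug uf x(5)] f g by simp
  moreover have "(low g \<cdot> low f) \<cdot> par x = par z"
    using comp_assoc[OF lg lf x(4)] f g by simp
  ultimately show ?thesis
    using f g comp_hom[OF lg lf] comp_hom[OF ug uf] unfolding hom_realization_cat by simp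
qed

lemma realization_cat_id:
  assumes "x \<in> realizations"
  shows "Id realization_cat x \<in> hom realization_cat x x"
proof -
  note x = realizationsD[OF assms]
  have "lower x \<in> Obj C" "upper x \<in> Obj C" using x(1,2) Mod_Obj by auto
  then show ?thesis
    using assms id_hom id_comp[OF x(3)] comp_id[OF x(3)] id_comp[OF x(4)] id_comp[OF x(5)]
    unfolding hom_realization_cat by simp
qed

lemma is_category_realization_cat: "is_category realization_cat"
  unfolding is_category_def
proof (intro conjI allI impI ballI)
  fix f assume "f \<in> Arr realization_cat"
  then show "Dom realization_cat f \<in> Obj realization_cat" "Cod realization_cat f \<in> Obj realization_cat"
    by (auto simp: realization_cat_def realization_arrow_def Let_def)
next
  fix x y f assume f: "f \<in> hom realization_cat x y"
  then have "low f \<cdot> Id C (lower x) = low f" "Id C (lower y) \<cdot> low f = low f"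
    "upp f \<cdot> Id C (upper x) = upp f" "Id C (upper y) \<cdot> upp f = upp f"
    unfolding hom_realization_cat using comp_id id_comp by blast+
  then show "f \<cdot>\<^bsub>realization_cat\<^esub> Id realization_cat x = f" "Id realization_cat y \<cdot>\<^bsub>realization_cat\<^esub> f = f"
    using f unfolding hom_realization_cat by (auto simp: prod_eq_iff)
next
  fix w x y z f g h
  assume "f \<in> hom realization_cat w x \<and> g \<in> hom realization_cat x y \<and> h \<in> hom realization_cat y z"
  then have "low h \<cdot> low g \<cdot> low f = (low h \<cdot> low g) \<cdot> low f"
    "upp h \<cdot> upp g \<cdot> upp f = (upp h \<cdot> upp g) \<cdot> upp f"
    unfolding hom_realization_cat using comp_assoc by blast+
  then show "h \<cdot>\<^bsub>realization_cat\<^esub> g \<cdot>\<^bsub>realization_cat\<^esub> f = (h \<cdot>\<^bsub>realization_cat\<^esub> g) \<cdot>\<^bsub>realization_cat\<^esub> f"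
    by simp
qed (use realization_cat_comp realization_cat_id in auto)

text \<open>Extension offers a copy \<open>b'\<close> of \<open>elt x\<close> that is independent of
  \<open>upper x\<close>, but an arrow has to carry \<open>elt x\<close> itself to the new element.
  Equality of types yields a model \<open>K\<close> where the two coincide. So
  \<open>upper x\<close> is mapped to \<open>K\<close> twice: by \<open>h \<cdot> f\<close>, the
  embedding of the new lower model, and by \<open>h'\<close>, the upper component of the
  arrow.\<close>

lemma realization_step:
  assumes x: "x \<in> realizations"
  shows "\<exists>y s. s \<in> hom realization_cat x y \<and> lower y = upper x \<and> low s = emb x"
proof -
  note x' = realizationsD[OF x]
  have Id: "Id C (upper x) \<in> hom C (upper x) (upper x)"
    using x'(2) Mod_Obj id_hom by blast
  have fact: "factors C (emb x) (Id C (upper x))"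
    using factorsI[OF Id x'(3)] id_comp[OF x'(3)] by simp
  \<comment> \<open>\<open>emb x\<close> is the right-hand side to be enlarged; as an entry of the
    type it makes \<open>h \<cdot> f\<close> and \<open>h'\<close> agree on \<open>lower x\<close>,
    which is the commuting square of the new arrow.\<close>
  obtain N f b' where f: "extension C Mod (upper x) N f"
    and gtp: "gtp_eq C Mod [b', f \<cdot> emb x, f \<cdot> emb x \<cdot> par x] N [elt x, emb x, emb x \<cdot> par x] (upper x)"
    and ind: "indep N b' (f \<cdot> emb x \<cdot> par x) (f \<cdot> Id C (upper x))"
    using extension_axiom[OF x'(6) hom_into[OF Id] fact] by blast
  have f: "f \<in> hom C (upper x) N" "N \<in> Mod" using f unfolding extension_def by auto
  have ind: "indep N b' (f \<cdot> emb x \<cdot> par x) f" using ind comp_id[OF f(1)] by simp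
  obtain K h h' where hK: "extension C Mod N K h" "extension C Mod (upper x) K h'"
    and eq: "h \<cdot> b' = h' \<cdot> elt x" "h \<cdot> f \<cdot> emb x = h' \<cdot> emb x"
    using gtp unfolding gtp_eq_def by auto
  have h: "h \<in> hom C N K" "h' \<in> hom C (upper x) K" "K \<in> Mod"
    using hK unfolding extension_def by auto
  have hf: "h \<cdot> f \<in> hom C (upper x) K" using comp_hom[OF h(1) f(1)] .
  have ep: "emb x \<cdot> par x \<in> hom C (Dom C (par x)) (upper x)" using comp_hom[OF x'(3,4)] .
  define y where "y = \<lparr>lower = upper x, upper = K, emb = h \<cdot> f, elt = h' \<cdot> elt x, par = emb x \<cdot> par x\<rparr>"
  have y: "lower y = upper x" "upper y = K" "emb y = h \<cdot> f" "elt y = h' \<cdot> elt x"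
    "par y = emb x \<cdot> par x" unfolding y_def by simp_all
  have "indep K (h \<cdot> b') (h \<cdot> f \<cdot> emb x \<cdot> par x) (h \<cdot> f)"
    using indep_push[OF ind h(1,3)] .
  then have "indep K (elt y) (emb y \<cdot> par y) (emb y)"
    using eq(1) comp_assoc[OF h(1) f(1) ep] unfolding y by simp
  then have "y \<in> realizations"
    using x'(2) h(3) hf hom_into[OF ep] unfolding realizations_def mem_Collect_eq y by simp
  moreover have "h' \<cdot> emb x = (h \<cdot> f) \<cdot> emb x"
    using eq(2) comp_assoc[OF h(1) f(1) x'(3)] by simp
  ultimately have "(x, y, emb x, h') \<in> hom realization_cat x y"
    using x x'(3) h(2) unfolding hom_realization_cat by (simp add: y)
  then show ?thesis using y(1) by (metis fst_conv snd_conv)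
qed

text \<open>Lower and upper models are glued separately, and the embeddings induce
  \<open>\<mu>\<close> between the colimits. Since arrows preserve elements and parameters, one
  element and one parameter result; the element is independent of each lower model over the
  parameter, and Union passes to their colimit.\<close>

lemma realization_colimit:
  assumes union: "ind_union U C Mod indep"
    and I: "directed_poset (I :: 'u set) r" and X: "diagram realization_cat I r X \<delta>"
  shows "\<exists>L l. cocone realization_cat I r X \<delta> L l \<and>
    colimit (full_sub C Mod) I r (\<lambda>i. lower (X i)) (\<lambda>i j. low (\<delta> i j)) (lower L) (\<lambda>i. low (l i))"
proof -
  have XR: "X i \<in> realizations" "\<delta> i i = Id realization_cat (X i)" if "i \<in> I" for i
    using X that unfolding diagram_def by simp_all
  note XD = realizationsD[OF XR(1)]
  have \<delta>: "\<delta> i j \<in> hom realization_cat (X i) (X j)" if "i \<in> I" "j \<in> I" "(i, j) \<in> r" for i j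
    using X that unfolding diagram_def by blast
  note \<delta>' = \<delta>[unfolded hom_realization_cat]
  have \<delta>\<delta>: "\<delta> j k \<cdot>\<^bsub>realization_cat\<^esub> \<delta> i j = \<delta> i k"
    if "i \<in> I" "j \<in> I" "k \<in> I" "(i, j) \<in> r" "(j, k) \<in> r" for i j k
    using X that unfolding diagram_def by blast
  have comp: "low (\<delta> j k) \<cdot> low (\<delta> i j) = low (\<delta> i k)" "upp (\<delta> j k) \<cdot> upp (\<delta> i j) = upp (\<delta> i k)"
    if "i \<in> I" "j \<in> I" "k \<in> I" "(i, j) \<in> r" "(j, k) \<in> r" for i j k
    using \<delta>\<delta>[OF that, symmetric] by simp_all
  have lowD: "diagram (full_sub C Mod) I r (\<lambda>i. lower (X i)) (\<lambda>i j. low (\<delta> i j))"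
    unfolding diagram_def using XR(2) XD(1) \<delta>' comp(1) by simp
  have uppD: "diagram (full_sub C Mod) I r (\<lambda>i. upper (X i)) (\<lambda>i j. upp (\<delta> i j))"
    unfolding diagram_def using XR(2) XD(2) \<delta>' comp(2) by simp
  obtain L l where L: "colimit (full_sub C Mod) I r (\<lambda>i. lower (X i)) (\<lambda>i j. low (\<delta> i j)) L l"
    using directed_colimit_exists[OF I lowD] by blast
  obtain K k where K: "colimit (full_sub C Mod) I r (\<lambda>i. upper (X i)) (\<lambda>i j. upp (\<delta> i j)) K k"
    using directed_colimit_exists[OF I uppD] by blast
  have Lc: "cocone (full_sub C Mod) I r (\<lambda>i. lower (X i)) (\<lambda>i j. low (\<delta> i j)) L l"
    using L unfolding colimit_def by (rule conjunct1)
  have Kc: "cocone (full_sub C Mod) I r (\<lambda>i. upper (X i)) (\<lambda>i j. upp (\<delta> i j)) K k"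
    using K unfolding colimit_def by (rule conjunct1)
  have LM: "L \<in> Mod" and KM: "K \<in> Mod" using Lc Kc unfolding cocone_def by simp_all
  have l: "l i \<in> hom C (lower (X i)) L" and k: "k i \<in> hom C (upper (X i)) K" if "i \<in> I" for i
    using Lc Kc that unfolding cocone_def by simp_all
  have l\<delta>: "l j \<cdot> low (\<delta> i j) = l i" and k\<delta>: "k j \<cdot> upp (\<delta> i j) = k i"
    if "i \<in> I" "j \<in> I" "(i, j) \<in> r" for i j
    using Lc Kc that unfolding cocone_def by simp_all
  have ke: "k i \<cdot> emb (X i) \<in> hom C (lower (X i)) K" if "i \<in> I" for i
    using comp_hom[OF k XD(3)] that by simp
  have e_cocone: "cocone (full_sub C Mod) I r (\<lambda>i. lower (X i)) (\<lambda>i j. low (\<delta> i j)) K (\<lambda>i. k i \<cdot> emb (X i))"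
    unfolding cocone_def
  proof (intro conjI ballI impI)
    fix i j assume ij: "i \<in> I" "j \<in> I" "(i, j) \<in> r"
    have "(k j \<cdot> emb (X j)) \<cdot> low (\<delta> i j) = k j \<cdot> upp (\<delta> i j) \<cdot> emb (X i)"
      using comp_assoc[OF k[OF ij(2)] XD(3)[OF ij(2)]] \<delta>'[OF ij] by metis
    also have "\<dots> = k i \<cdot> emb (X i)"
      using comp_assoc[OF k[OF ij(2)] _ XD(3)[OF ij(1)]] \<delta>'[OF ij] k\<delta>[OF ij] by metis
    finally show "(k j \<cdot> emb (X j)) \<cdot>\<^bsub>full_sub C Mod\<^esub> low (\<delta> i j) = k i \<cdot> emb (X i)"
      by simp
  qed (use KM XD(1) ke in simp_all)
  obtain \<mu> where "\<mu> \<in> hom (full_sub C Mod) L K"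
    "\<forall>i\<in>I. \<mu> \<cdot>\<^bsub>full_sub C Mod\<^esub> l i = k i \<cdot> emb (X i)"
    by (rule sub.colimit_mediator[OF L e_cocone])
  then have \<mu>: "\<mu> \<in> hom C L K" and \<mu>l: "\<And>i. i \<in> I \<Longrightarrow> \<mu> \<cdot> l i = k i \<cdot> emb (X i)" by simp_all
  obtain i0 where i0: "i0 \<in> I" using I unfolding directed_poset_def by blast
  define b c where "b = k i0 \<cdot> elt (X i0)" and "c = l i0 \<cdot> par (X i0)"
  have mono_b: "k j \<cdot> elt (X j) = k i \<cdot> elt (X i)" and mono_c: "l j \<cdot> par (X j) = l i \<cdot> par (X i)"
    if ij: "i \<in> I" "j \<in> I" "(i, j) \<in> r" for i j
  proof -
    show "k j \<cdot> elt (X j) = k i \<cdot> elt (X i)"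
      using comp_assoc[OF k[OF ij(2)] _ XD(5)[OF ij(1)]] \<delta>'[OF ij] k\<delta>[OF ij] by metis
    show "l j \<cdot> par (X j) = l i \<cdot> par (X i)"
      using comp_assoc[OF l[OF ij(2)] _ XD(4)[OF ij(1)]] \<delta>'[OF ij] l\<delta>[OF ij] by metis
  qed
  \<comment> \<open>By directedness \<open>i\<close> and \<open>i0\<close> have a common later
    stage, so the choice of \<open>i0\<close> is immaterial.\<close>
  have bi: "k i \<cdot> elt (X i) = b" and ci: "l i \<cdot> par (X i) = c" if i: "i \<in> I" for i
  proof -
    obtain j where j: "j \<in> I" "(i, j) \<in> r" "(i0, j) \<in> r"
      using I i i0 unfolding directed_poset_def by blast
    show "k i \<cdot> elt (X i) = b"
      using mono_b[OF i j(1,2)] mono_b[OF i0 j(1,3)] unfolding b_def by simp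
    show "l i \<cdot> par (X i) = c"
      using mono_c[OF i j(1,2)] mono_c[OF i0 j(1,3)] unfolding c_def by simp
  qed
  have c: "into C L c"
    unfolding c_def using hom_into[OF comp_hom[OF l XD(4)]] i0 by simp
  have ind: "indep K b (\<mu> \<cdot> c) (\<mu> \<cdot> l i)" if i: "i \<in> I" for i
  proof -
    have "k i \<cdot> emb (X i) \<cdot> par (X i) = (\<mu> \<cdot> l i) \<cdot> par (X i)"
      using comp_assoc[OF k[OF i] XD(3)[OF i] XD(4)[OF i]] \<mu>l[OF i] by simp
    also have "\<dots> = \<mu> \<cdot> c"
      using comp_assoc[OF \<mu> l[OF i] XD(4)[OF i]] ci[OF i] by simp
    finally show ?thesis
      using indep_push[OF XD(6)[OF i] k[OF i] KM] bi[OF i] \<mu>l[OF i] by simp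
  qed
  have \<mu>c: "cocone C I r (\<lambda>i. lower (X i)) (\<lambda>i j. low (\<delta> i j)) K (\<lambda>i. \<mu> \<cdot> l i)"
    by (rule cocone_comp[OF diagram_full_sub[OF Mod_Obj lowD] cocone_full_sub[OF Mod_Obj Lc] \<mu>])
  \<comment> \<open>Union speaks of colimits in \<open>C\<close>; here the inclusion of the models
    has to preserve directed colimits.\<close>
  have "indep K b (\<mu> \<cdot> c) \<mu>"
    using union[unfolded ind_union_def, rule_format, of I r "\<lambda>i. lower (X i)" "\<lambda>i j. low (\<delta> i j)"
        K "\<lambda>i. \<mu> \<cdot> l i" L l \<mu> b "\<mu> \<cdot> c"]
      I diagram_full_sub[OF Mod_Obj lowD] KM \<mu>c directed_colimit_preserved[OF I lowD L] \<mu> ind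
    by simp
  moreover define y where "y = \<lparr>lower = L, upper = K, emb = \<mu>, elt = b, par = c\<rparr>"
  have y: "lower y = L" "upper y = K" "emb y = \<mu>" "elt y = b" "par y = c"
    unfolding y_def by simp_all
  ultimately have yR: "y \<in> realizations"
    using LM KM \<mu> c unfolding realizations_def mem_Collect_eq y by simp
  define t where "t i = (X i, y, l i, k i)" for i
  have t: "t i \<in> hom realization_cat (X i) y" if "i \<in> I" for i
    unfolding hom_realization_cat t_def
    using XR(1)[OF that] yR l[OF that] k[OF that] \<mu>l[OF that] bi[OF that] ci[OF that] by (simp add: y)
  have "cocone realization_cat I r X \<delta> y t"
    unfolding cocone_def
  proof (intro conjI ballI impI)
    fix i j assume ij: "i \<in> I" "j \<in> I" "(i, j) \<in> r"
    then show "t j \<cdot>\<^bsub>realization_cat\<^esub> \<delta> i j = t i"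
      using \<delta>'[OF ij] l\<delta>[OF ij] k\<delta>[OF ij] by (simp add: t_def)
  qed (use yR t in simp_all)
  moreover have "colimit (full_sub C Mod) I r (\<lambda>i. lower (X i)) (\<lambda>i j. low (\<delta> i j)) (lower y) (\<lambda>i. low (t i))"
    using L by (simp add: y t_def)
  ultimately show ?thesis by blast
qed

text \<open>The initial segments are the lower models of a chain of realizations. The element of
  stage \<open>i\<close> lives in \<open>upper (X i)\<close>, which is the lower model of the
  successor stage, so it falls into the segment where it is required.\<close>

lemma independent_isi_sequence:
  fixes \<nu> :: "'u rel"
  defines "z \<equiv> wo_rel.minim \<nu> (Field \<nu>)"
  assumes union: "ind_union U C Mod indep" and \<nu>: "reg_card \<nu>"
    and M: "M \<in> Mod" and b: "into C M b" and c: "into C M c" "Dom C c \<in> base"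
  shows "\<exists>N bs X \<delta> m. X z = M \<and>
    diagram (full_sub C Mod) (Field \<nu>) \<nu> X \<delta> \<and> cocone (full_sub C Mod) (Field \<nu>) \<nu> X \<delta> N m \<and>
    isi_sequence C Mod \<nu> bs N (m z \<cdot> c) \<and>
    (\<forall>i\<in>Field \<nu>. gtp_eq C Mod [bs i, m z \<cdot> c] N [b, c] M \<and>
      factors C (bs i) (m (wo_rel.suc \<nu> {i})) \<and> indep N (bs i) (m z \<cdot> c) (m i))"
proof -
  interpret R: cat realization_cat by (unfold_locales) (rule is_category_realization_cat)
  obtain N0 f b0 where f: "extension C Mod M N0 f" "into C N0 b0"
    and gtp0: "gtp_eq C Mod [b0, f \<cdot> c] N0 [b, c] M" and ind0: "indep N0 b0 (f \<cdot> c) f"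
    using independent_realization[OF M b c] by blast
  \<comment> \<open>The first segment is \<open>M\<close> itself, with \<open>b\<close> replaced by
    a realisation \<open>b0\<close> independent of \<open>M\<close> over \<open>c\<close>; all later
    elements are images of \<open>b0\<close>.\<close>
  define x0 where "x0 = \<lparr>lower = M, upper = N0, emb = f, elt = b0, par = c\<rparr>"
  have x0: "lower x0 = M" "upper x0 = N0" "emb x0 = f" "elt x0 = b0" "par x0 = c"
    unfolding x0_def by simp_all
  have x0R: "x0 \<in> realizations"
    using f c ind0 unfolding realizations_def mem_Collect_eq x0 extension_def by simp
  let ?s = "\<lambda>i. wo_rel.suc \<nu> {i}"
  \<comment> \<open>This identifies the upper model of a stage with the lower model of its
    successor, with \<open>emb\<close> as connecting arrow.\<close>
  define S where "S g s \<longleftrightarrow> lower (fst (snd s)) = upper (fst s) \<and> low s = emb (fst s)"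
    for g s :: "('o, 'a) realization_arrow"
  have "\<exists>X \<delta>. diagram realization_cat (Field \<nu>) \<nu> X \<delta> \<and> X z = x0 \<and>
    (\<forall>i\<in>Field \<nu>. S (\<delta> z i) (\<delta> i (?s i))) \<and>
    (\<forall>k. limit_element \<nu> k \<longrightarrow>
      colimit (full_sub C Mod) (underS \<nu> k) \<nu> (\<lambda>i. lower (X i)) (\<lambda>i j. low (\<delta> i j))
        (lower (X k)) (\<lambda>i. low (\<delta> i k)))"
    unfolding z_def
  proof (rule R.continuous_chain[where F = lower and G = "\<lambda>f. low f", OF \<nu>])
    show "\<exists>Y s. s \<in> hom realization_cat x Y \<and> S g s" if "g \<in> hom realization_cat x0 x" for x g
    proof -
      have "x \<in> realizations" using that unfolding hom_realization_cat by simp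
      then obtain y s where s: "s \<in> hom realization_cat x y" "lower y = upper x" "low s = emb x"
        using realization_step by blast
      moreover from s have "S g s" unfolding S_def hom_realization_cat by simp
      ultimately show ?thesis by blast
    qed
    show "\<exists>L l. cocone realization_cat I r X \<delta> L l \<and>
      colimit (full_sub C Mod) I r (\<lambda>i. lower (X i)) (\<lambda>i j. low (\<delta> i j)) (lower L) (\<lambda>i. low (l i))"
      if "directed_poset I r" "diagram realization_cat I r X \<delta>" for I :: "'u set" and r X \<delta>
      using realization_colimit[OF union that] .
  qed (simp add: x0R)
  then obtain X \<delta> where X: "diagram realization_cat (Field \<nu>) \<nu> X \<delta>" "X z = x0"
    and S: "\<forall>i\<in>Field \<nu>. S (\<delta> z i) (\<delta> i (?s i))"
    and lim: "\<forall>k. limit_element \<nu> k \<longrightarrow>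
      colimit (full_sub C Mod) (underS \<nu> k) \<nu> (\<lambda>i. lower (X i)) (\<lambda>i j. low (\<delta> i j))
        (lower (X k)) (\<lambda>i. low (\<delta> i k))"
    by blast
  have XR: "X i \<in> realizations" "\<delta> i i = Id realization_cat (X i)" if "i \<in> Field \<nu>" for i
    using X(1) that unfolding diagram_def by simp_all
  note XD = realizationsD[OF XR(1)]
  have \<delta>: "\<delta> i j \<in> hom realization_cat (X i) (X j)" if "(i, j) \<in> \<nu>" for i j
    using X(1) that reg_card_Field[OF \<nu> that] unfolding diagram_def by simp
  note \<delta>' = \<delta>[unfolded hom_realization_cat]
  have \<delta>\<delta>: "low (\<delta> j k) \<cdot> low (\<delta> i j) = low (\<delta> i k)" if "(i, j) \<in> \<nu>" "(j, k) \<in> \<nu>" for i j k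
  proof -
    have "\<delta> i k = \<delta> j k \<cdot>\<^bsub>realization_cat\<^esub> \<delta> i j"
      using X(1) that reg_card_Field[OF \<nu> that(1)] reg_card_Field[OF \<nu> that(2)]
      unfolding diagram_def by metis
    then show ?thesis by simp
  qed
  define Y \<epsilon> where "Y = (\<lambda>i. lower (X i))" and "\<epsilon> = (\<lambda>i j. low (\<delta> i j))"
  have Y: "diagram (full_sub C Mod) (Field \<nu>) \<nu> Y \<epsilon>"
    unfolding diagram_def Y_def \<epsilon>_def using XR(2) XD(1) \<delta>' \<delta>\<delta> by simp
  have Yz: "Y z = M" unfolding Y_def using X(2) x0 by simp
  obtain N m where m: "cocone (full_sub C Mod) (Field \<nu>) \<nu> Y \<epsilon> N m"
    using chain_cocone[OF \<nu> Y] by blast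
  have N: "N \<in> Mod" using m unfolding cocone_def by simp
  have m_hom: "m i \<in> hom C (lower (X i)) N" if "i \<in> Field \<nu>" for i
    using m that unfolding cocone_def Y_def by simp
  have m\<epsilon>: "m j \<cdot> low (\<delta> i j) = m i" if "(i, j) \<in> \<nu>" for i j
    using m that reg_card_Field[OF \<nu> that] unfolding cocone_def \<epsilon>_def by simp
  have suc: "(i, ?s i) \<in> \<nu>" "?s i \<in> Field \<nu>" if "i \<in> Field \<nu>" for i
    using reg_card_suc[OF \<nu> that] by auto
  have S': "lower (X (?s i)) = upper (X i)" "low (\<delta> i (?s i)) = emb (X i)" if "i \<in> Field \<nu>" for i
    using bspec[OF S that] \<delta>'[OF suc(1)[OF that]] unfolding S_def by simp_all
  have m_suc: "m (?s i) \<in> hom C (upper (X i)) N" if "i \<in> Field \<nu>" for i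
    using m_hom[OF suc(2)[OF that]] S'(1)[OF that] by simp
  have z: "(z, i) \<in> \<nu>" if "i \<in> Field \<nu>" for i
    using reg_card_minim[OF \<nu> that] unfolding z_def .
  have zF: "z \<in> Field \<nu>"
    using z reg_card_Field[OF \<nu>] reg_card_Field_nonempty[OF \<nu>] by blast
  define bs where "bs i = m (?s i) \<cdot> elt (X i)" for i
  \<comment> \<open>The source pair does not depend on \<open>j\<close>. Through
    \<open>upper (X j)\<close>, the segment after \<open>j\<close>, \<open>upper (X i)\<close> is
    mapped to \<open>N\<close>; this takes the element to \<open>bs j\<close> and, by the commuting
    square, restricts to \<open>m i\<close> on the lower model. Comparing \<open>j\<close> with
    \<open>i\<close> gives the isi condition.\<close>
  have gtp_seq: "gtp_eq C Mod [elt (X i), emb (X i)] (upper (X i)) [bs j, m i] N" if ij: "(i, j) \<in> \<nu>" for i j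
  proof -
    have iF: "i \<in> Field \<nu>" and jF: "j \<in> Field \<nu>" using reg_card_Field[OF \<nu> ij] by auto
    have u: "upp (\<delta> i j) \<in> hom C (upper (X i)) (upper (X j))" using \<delta>'[OF ij] by simp
    let ?v = "m (?s j) \<cdot> upp (\<delta> i j)"
    have v: "?v \<in> hom C (upper (X i)) N" using comp_hom[OF m_suc[OF jF] u] .
    have "?v \<cdot> elt (X i) = bs j"
      using comp_assoc[OF m_suc[OF jF] u XD(5)[OF iF]] \<delta>'[OF ij] unfolding bs_def by simp
    moreover have "?v \<cdot> emb (X i) = m i"
    proof -
      have "?v \<cdot> emb (X i) = m (?s j) \<cdot> emb (X j) \<cdot> low (\<delta> i j)"
        using comp_assoc[OF m_suc[OF jF] u XD(3)[OF iF]] \<delta>'[OF ij] by simp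
      also have "\<dots> = (m (?s j) \<cdot> emb (X j)) \<cdot> low (\<delta> i j)"
        using comp_assoc[OF m_suc[OF jF] XD(3)[OF jF]] \<delta>'[OF ij] by blast
      also have "\<dots> = m i"
        using m\<epsilon>[OF suc(1)[OF jF]] S'(2)[OF jF] m\<epsilon>[OF ij] by simp
      finally show ?thesis .
    qed
    ultimately show ?thesis
      using gtp_eq_push[OF v XD(2)[OF iF] N, of "[elt (X i), emb (X i)]"]
        hom_into[OF XD(5)[OF iF]] hom_into[OF XD(3)[OF iF]] by simp
  qed
  have gtp_isi: "gtp_eq C Mod [bs i, m i] N [bs j, m i] N" if ij: "(i, j) \<in> \<nu>" for i j
  proof -
    have "(i, i) \<in> \<nu>" using reg_card_refl[OF \<nu>] reg_card_Field[OF \<nu> ij] by blast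
    then show ?thesis
      using gtp_eq_trans[OF gtp_eq_sym[OF gtp_seq] gtp_seq[OF ij]] by blast
  qed
  \<comment> \<open>The arrow from the first stage carries \<open>b0\<close> to
    \<open>elt (X i)\<close>, so each element has the type of \<open>b0\<close>, hence that of
    \<open>b\<close>, over \<open>c\<close>.\<close>
  have realizes: "gtp_eq C Mod [elt (X i), \<epsilon> i (?s i) \<cdot> \<epsilon> z i \<cdot> c] (Y (?s i)) [b, c] M \<and>
      indep (Y (?s i)) (elt (X i)) (\<epsilon> i (?s i) \<cdot> \<epsilon> z i \<cdot> c) (\<epsilon> i (?s i))" if i: "i \<in> Field \<nu>" for i
  proof -
    have par: "par (X i) = \<epsilon> z i \<cdot> c"
      using \<delta>'[OF z[OF i]] X(2) x0 unfolding \<epsilon>_def by simp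
    have \<epsilon>s: "\<epsilon> i (?s i) = emb (X i)" "Y (?s i) = upper (X i)"
      using S'[OF i] unfolding \<epsilon>_def Y_def by simp_all
    have u: "upp (\<delta> z i) \<in> hom C N0 (upper (X i))" "upp (\<delta> z i) \<cdot> b0 = elt (X i)"
      "upp (\<delta> z i) \<cdot> f = emb (X i) \<cdot> \<epsilon> z i" "\<epsilon> z i \<in> hom C M (lower (X i))"
      using \<delta>'[OF z[OF i]] X(2) x0 unfolding \<epsilon>_def by simp_all
    have fh: "f \<in> hom C M N0" "N0 \<in> Mod" and ch: "c \<in> hom C (Dom C c) M"
      using f c(1) unfolding extension_def into_hom by auto
    have "upp (\<delta> z i) \<cdot> f \<cdot> c = emb (X i) \<cdot> \<epsilon> z i \<cdot> c"
      using comp_assoc[OF u(1) fh(1) ch] comp_assoc[OF XD(3)[OF i] u(4) ch] u(3) by simp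
    then have "gtp_eq C Mod [b0, f \<cdot> c] N0 [elt (X i), emb (X i) \<cdot> \<epsilon> z i \<cdot> c] (upper (X i))"
      using gtp_eq_push[OF u(1) fh(2) XD(2)[OF i], of "[b0, f \<cdot> c]"] f(2)
        hom_into[OF comp_hom[OF fh(1) ch]] u(2) by simp
    then have "gtp_eq C Mod [elt (X i), emb (X i) \<cdot> \<epsilon> z i \<cdot> c] (upper (X i)) [b, c] M"
      using gtp_eq_trans[OF gtp_eq_sym gtp0] by blast
    then show ?thesis
      using XD(6)[OF i] unfolding \<epsilon>s par by simp
  qed
  have props: "\<forall>i\<in>Field \<nu>. gtp_eq C Mod [bs i, m z \<cdot> c] N [b, c] M \<and>
      factors C (bs i) (m (?s i)) \<and> indep N (bs i) (m z \<cdot> c) (m i)"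
  proof
    fix i assume i: "i \<in> Field \<nu>"
    note ri = realizes[OF i, unfolded z_def]
    show "gtp_eq C Mod [bs i, m z \<cdot> c] N [b, c] M \<and>
      factors C (bs i) (m (?s i)) \<and> indep N (bs i) (m z \<cdot> c) (m i)"
      unfolding bs_def z_def
      by (rule push_along_cocone[OF \<nu> Y Yz[unfolded z_def] m c(1) i conjunct1[OF ri] conjunct2[OF ri]])
  qed
  have bs_hom: "bs i \<in> hom C (Dom C b) N" if "i \<in> Field \<nu>" for i
    using props that unfolding gtp_eq_def by (auto simp: into_hom)
  have mz: "m z \<in> hom C M N" using m_hom[OF zF] Yz unfolding Y_def by simp
  have ch: "c \<in> hom C (Dom C c) M" using c(1) unfolding into_hom .
  have "chain_of_initial_segments C Mod \<nu> bs N Y \<epsilon> m"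
    unfolding chain_of_initial_segments_def
    using N bs_hom Y lim m props unfolding Y_def \<epsilon>_def by blast
  then have "isi_sequence C Mod \<nu> bs N (m z \<cdot> c)"
    unfolding isi_sequence_def
    using hom_into[OF comp_hom[OF mz ch]] factorsI[OF mz ch] gtp_isi unfolding z_def by blast
  then show ?thesis using Yz Y m props by blast
qed

end

theorem theorem7p1:
  fixes U :: "'u itself"
    and C :: "('o, 'a) category"
    and Mod base :: "'o set"
    and indep :: "('o, 'a) indep_rel"
  assumes "universe U"
    and "AECat U C Mod"
    and "amalgamation C Mod"
    and "club_local_character U C Mod indep"
  shows
    "(basic U C Mod base indep \<longrightarrow>
        (\<forall>M \<in> Mod. \<forall>a b c. into C M a \<and> into C M b \<and> into C M c \<and> Dom C c \<in> base \<longrightarrow>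
           isi_d_indep U C Mod M a c b \<longrightarrow> indep M a c b)) \<and>
     (basic_without_union C Mod base indep \<longrightarrow>
        (\<forall>M \<in> Mod. \<forall>a b c. into C M a \<and> into C M b \<and> into C M c \<and> Dom C c \<in> base \<longrightarrow>
           ld_indep U C Mod M a c b \<longrightarrow> indep M a c b))"
proof (intro conjI impI ballI allI; elim conjE)
  fix M a b c
  assume "basic U C Mod base indep" and M: "M \<in> Mod"
    and abc: "into C M a" "into C M b" "into C M c" "Dom C c \<in> base"
    and nd: "isi_d_indep U C Mod M a c b"
  then have union: "ind_union U C Mod indep" and basic: "basic_without_union C Mod base indep"
    unfolding basic_def by auto
  interpret independence U C Mod base indep
    using assms basic by unfold_locales auto
  show "indep M a c b"
  proof (rule indep_if_not_divides[OF assms(1,4) M abc(1,3)])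
    show "\<not> divides_along (\<lambda>(\<nu> :: 'u rel) bs N c'. isi_sequence C Mod \<nu> bs N c') C Mod a b c M"
      using nd unfolding isi_d_indep_def isi_divides_def by blast
  qed (use independent_isi_sequence[OF union _ M abc(2-4)] in blast)
next
  fix M a b c
  assume basic: "basic_without_union C Mod base indep" and M: "M \<in> Mod"
    and abc: "into C M a" "into C M b" "into C M c" "Dom C c \<in> base"
    and nd: "ld_indep U C Mod M a c b"
  interpret independence U C Mod base indep
    using assms basic by unfold_locales auto
  show "indep M a c b"
  proof (rule indep_if_not_divides[OF assms(1,4) M abc(1,3)])
    show "\<not> divides_along (\<lambda>(\<nu> :: 'u rel) bs N c'. True) C Mod a b c M"
      using nd unfolding ld_indep_def long_divides_def by blast
  qed (use independent_sequence[OF _ M abc(2-4)] in blast)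
qed

end
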